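(* Let $\epsilon\in\{-1,1\}$ be fixed. The equivalence group $G^\sim_{\mathcal F'^\epsilon}$ of the class $\mathcal F'^\epsilon$ of reduced Fokker--Planck equations with time-independent drifts, $u_t=\epsilon u_{xx}+(B(x)u)_x$, consists of the point transformations of the form \[ \tilde t=c_1^2t+c_2,\quad\tilde x=c_1x+c_3,\quad\tilde u=c_4u,\quad\tilde B=\frac1{c_1}B, \] where $c_1,\dots,c_4$ are arbitrary constants with $c_1c_4\neq0$.
   Context: Everything is real, smooth and local. The arbitrary element of the class is the smooth function $B$ of $x$, regarded as a coordinate when working with equivalence transformations. The (usual) equivalence (pseudo)group of the class consists of the point transformations (local diffeomorphisms) in the space with coordinates $(t,x,u_{(2)},B)$, where $u_{(2)}$ denotes $u$ and its derivatives up to order two (with components for derivatives of $B$ obtained by prolongation if these are needed), that are projectable to the spaces of $(t,x,u)$ and of $(t,x,u_{(2)})$, are consistent with the contact structure of the second-order jet space (so their components for derivatives are obtained by standard prolongation and are not listed), and map every equation of the class to an equation of the class (with the transformed arbitrary element) for any value of the arbitrary element. *)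

theory Defs
  imports "HOL-Analysis.Analysis"
begin

fun Ck_on :: "nat \<Rightarrow> 'a::euclidean_space set \<Rightarrow> ('a \<Rightarrow> 'b::euclidean_space) \<Rightarrow> bool" where
  "Ck_on 0 S f \<longleftrightarrow> continuous_on S f"
| "Ck_on (Suc k) S f \<longleftrightarrow>
     (\<forall>x\<in>S. f differentiable (at x)) \<and>
     (\<forall>v. Ck_on k S (\<lambda>x. frechet_derivative f (at x) v))"

text \<open>Only used for open \<open>S\<close>: the derivatives are taken at points, not within \<open>S\<close>.\<close>

definition smooth_on :: "'a::euclidean_space set \<Rightarrow> ('a \<Rightarrow> 'b::euclidean_space) \<Rightarrow> bool" where
  "smooth_on S f \<longleftrightarrow> (\<forall>k. Ck_on k S f)"

text \<open>
  Coordinates: \<open>(t, x, u)\<close> on the base; \<open>((t, x, u), (u_t, u_x), (u_tt, u_tx, u_xx))\<close> on the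
  second-order jet space; \<open>(z, B)\<close>, with \<open>z\<close> a jet, on the space on which equivalence
  transformations act.
\<close>

type_synonym base = "real \<times> real \<times> real"
type_synonym jet2 = "base \<times> (real \<times> real) \<times> (real \<times> real \<times> real)"
type_synonym extjet2 = "jet2 \<times> real"

definition base_of :: "extjet2 \<Rightarrow> base" where
  "base_of p = fst (fst p)"

definition xcoord :: "jet2 \<Rightarrow> real" where
  "xcoord z = fst (snd (fst z))"

text \<open>
  The fibre at a jet of the Cartan distribution, i.e. the common kernel of the contact forms
  \<open>du - u_t dt - u_x dx\<close>, \<open>du_t - u_tt dt - u_tx dx\<close> and \<open>du_x - u_tx dt - u_xx dx\<close>.
\<close>

fun cartan :: "jet2 \<Rightarrow> jet2 set" where
  "cartan ((t, x, u), (ut, ux), (utt, utx, uxx)) =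
     {((dt, dx, du), (dut, dux), w) | dt dx du dut dux w.
        du = ut * dt + ux * dx \<and>
        dut = utt * dt + utx * dx \<and>
        dux = utx * dt + uxx * dx}"

definition transformation_domain :: "extjet2 set \<Rightarrow> bool" where
  "transformation_domain D \<longleftrightarrow> open D \<and> connected D \<and> D \<noteq> {}"

definition diffeomorphism_on :: "'a::euclidean_space set \<Rightarrow> ('a \<Rightarrow> 'a) \<Rightarrow> bool" where
  "diffeomorphism_on D \<Phi> \<longleftrightarrow>
     smooth_on D \<Phi> \<and> open (\<Phi> ` D) \<and>
     (\<exists>\<Psi>. smooth_on (\<Phi> ` D) \<Psi> \<and> (\<forall>p\<in>D. \<Psi> (\<Phi> p) = p))"

definition projectable :: "extjet2 set \<Rightarrow> (extjet2 \<Rightarrow> extjet2) \<Rightarrow> bool" where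
  "projectable D \<Phi> \<longleftrightarrow>
     (\<exists>\<phi>. \<forall>p\<in>D. base_of (\<Phi> p) = \<phi> (base_of p)) \<and>
     (\<exists>\<psi>. \<forall>p\<in>D. fst (\<Phi> p) = \<psi> (fst p))"

text \<open>
  For a projectable diffeomorphism, preserving the Cartan distribution is equivalent to the
  components for derivatives being given by the standard prolongation formulas.
\<close>

definition contact_consistent :: "extjet2 set \<Rightarrow> (extjet2 \<Rightarrow> extjet2) \<Rightarrow> bool" where
  "contact_consistent D \<Phi> \<longleftrightarrow>
     (\<forall>p\<in>D. \<forall>v\<in>cartan (fst p). \<forall>w.
        fst (frechet_derivative \<Phi> (at p) (v, w)) \<in> cartan (fst (\<Phi> p)))"

text \<open>
  A class of equations with one arbitrary element of \<open>x\<close> is a map \<open>E\<close> that assigns to each such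
  element, a function \<open>B\<close> smooth on an open set \<open>I\<close> of reals, the locus \<open>E I B\<close> of the
  corresponding equation in the jet space. The transformed element is the function whose graph,
  over the jet space, is the image of the graph of the original one; it has to depend on the
  transformed \<open>x\<close> only.
\<close>

definition preserves_class ::
    "(real set \<Rightarrow> (real \<Rightarrow> real) \<Rightarrow> jet2 set) \<Rightarrow> extjet2 set \<Rightarrow> (extjet2 \<Rightarrow> extjet2) \<Rightarrow> bool" where
  "preserves_class E D \<Phi> \<longleftrightarrow>
     (\<forall>I B. open I \<and> smooth_on I B \<longrightarrow>
        (\<exists>J B'. open J \<and> smooth_on J B' \<and>
           (\<forall>z. xcoord z \<in> I \<and> (z, B (xcoord z)) \<in> D \<longrightarrow>
              (let (z', b') = \<Phi> (z, B (xcoord z)) in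
                 xcoord z' \<in> J \<and> b' = B' (xcoord z') \<and>
                 (z \<in> E I B \<longleftrightarrow> z' \<in> E J B')))))"

text \<open>
  The equivalence pseudogroup, as the set of transformations \<open>\<Phi>\<close> together with their domains
  \<open>D\<close>. The values of \<open>\<Phi>\<close> outside \<open>D\<close> play no role.
\<close>

definition equivalence_group ::
    "(real set \<Rightarrow> (real \<Rightarrow> real) \<Rightarrow> jet2 set) \<Rightarrow> (extjet2 set \<times> (extjet2 \<Rightarrow> extjet2)) set" where
  "equivalence_group E =
     {(D, \<Phi>). transformation_domain D \<and> diffeomorphism_on D \<Phi> \<and> projectable D \<Phi> \<and>
        contact_consistent D \<Phi> \<and> preserves_class E D \<Phi>}"

text \<open>
  The class \<open>u_t = \<epsilon> u_xx + (B(x) u)_x\<close>, with the total derivative \<open>(B u)_x\<close> expanded by the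
  product rule.
\<close>

definition fokker_planck_class :: "real \<Rightarrow> real set \<Rightarrow> (real \<Rightarrow> real) \<Rightarrow> jet2 set" where
  "fokker_planck_class \<epsilon> I B =
     {((t, x, u), (ut, ux), (utt, utx, uxx)) | t x u ut ux utt utx uxx.
        x \<in> I \<and> ut = \<epsilon> * uxx + (deriv B x * u + B x * ux)}"

end

theory Submission imports Defs begin

text \<open>
  Two arbitrary elements with the same value but different slopes at a point show that \<open>X\<close> depends
  on \<open>x\<close> only, that \<open>\<beta>\<close>, the component for \<open>B\<close>, depends on \<open>(x, B)\<close> only, and that the slope of the
  transformed element is \<open>(\<beta>_x + B_x \<beta>_B) / X_x\<close>. Where \<open>u\<close> does not vanish, the slope \<open>B_x\<close> can be
  chosen so that a given jet satisfies the equation, which turns the invariance condition into an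
  identity in all variables. Differentiating it with respect to \<open>u_tt\<close> gives \<open>T = T(t)\<close>; \<open>u_t\<close> and
  \<open>u_xx\<close> give \<open>T_t = X_x^2\<close>, so both are locally constant; two derivatives in \<open>u_x\<close> give \<open>U_uu = 0\<close>,
  whence \<open>\<beta>_B X_x = 1\<close> and \<open>U = u U_u\<close>; the derivative in \<open>B\<close> gives \<open>U_x = 0\<close>, and what remains
  gives \<open>\<beta> = B / X_x\<close> and \<open>U_t = 0\<close>. These relations extend by continuity across \<open>u = 0\<close>, and since
  the domain is connected, \<open>X_x\<close> and \<open>U_u\<close> are constant on it.
\<close>

subsection \<open>Directional derivatives\<close>

text \<open>The direction comes first so that \<open>pd v f\<close> is again a real function, to
  which \<open>pd w\<close> can be applied.\<close>

definition pd :: "'a \<Rightarrow> ('a::euclidean_space \<Rightarrow> real) \<Rightarrow> 'a \<Rightarrow> real" where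
  "pd v f p = frechet_derivative f (at p) v"

lemma pd_eqI: "(f has_derivative f') (at p) \<Longrightarrow> pd v f p = f' v"
  unfolding pd_def by (metis frechet_derivative_at)

lemma has_derivative_pd:
  "f differentiable at p \<Longrightarrow> (f has_derivative (\<lambda>v. pd v f p)) (at p)"
  unfolding pd_def using frechet_derivative_works by auto

lemma pd_const: "pd v (\<lambda>q. c) p = 0"
  by (simp add: pd_def)

lemma pd_add:
  assumes "f differentiable at p" "g differentiable at p"
  shows "pd v (\<lambda>q. f q + g q) p = pd v f p + pd v g p"
  by (rule pd_eqI[OF has_derivative_add[OF assms[THEN has_derivative_pd]]])

lemma pd_diff:
  assumes "f differentiable at p" "g differentiable at p"
  shows "pd v (\<lambda>q. f q - g q) p = pd v f p - pd v g p"
  by (rule pd_eqI[OF has_derivative_diff[OF assms[THEN has_derivative_pd]]])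

lemma pd_mult:
  assumes "f differentiable at p" "g differentiable at p"
  shows "pd v (\<lambda>q. f q * g q) p = f p * pd v g p + pd v f p * g p"
  by (rule pd_eqI[OF has_derivative_mult[OF assms[THEN has_derivative_pd]]])

lemma pd_power2:
  assumes "f differentiable at p"
  shows "pd v (\<lambda>q. (f q)\<^sup>2) p = 2 * f p * pd v f p"
  using pd_mult[OF assms assms] by (simp add: power2_eq_square)

text \<open>On an open set both functions have the same derivatives at \<open>p\<close>, so the
  choice made by \<open>frechet_derivative\<close> is the same for both.\<close>

lemma pd_cong:
  assumes "open S" "p \<in> S" "\<And>q. q \<in> S \<Longrightarrow> f q = g q"
  shows "pd v f p = pd v g p"
proof -
  have "(f has_derivative f') (at p) \<longleftrightarrow> (g has_derivative f') (at p)" for f'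
    using has_derivative_transform_within_open[of f f' p UNIV S g]
      has_derivative_transform_within_open[of g f' p UNIV S f] assms by auto
  then show ?thesis by (simp add: pd_def frechet_derivative_def)
qed

lemma pd_linear:
  assumes "f differentiable at p"
  shows "pd (v + w) f p = pd v f p + pd w f p" "pd (c *\<^sub>R v) f p = c * pd v f p" "pd 0 f p = 0"
proof -
  interpret bounded_linear "\<lambda>v. pd v f p"
    using has_derivative_pd[OF assms] by (rule has_derivative_bounded_linear)
  show "pd (v + w) f p = pd v f p + pd w f p" "pd (c *\<^sub>R v) f p = c * pd v f p" "pd 0 f p = 0"
    by (simp_all add: add scaleR zero)
qed

text \<open>
  The only commutation of partial derivatives that is needed. It holds for differentiable functions,
  since a function with vanishing derivative along \<open>w\<close> is locally invariant under translations by
  multiples of \<open>w\<close>; so no form of the symmetry of second derivatives has to be proved.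
\<close>

lemma pd_pd_eq_0:
  assumes S: "open S" "p \<in> S"
    and f: "\<And>q. q \<in> S \<Longrightarrow> f differentiable at q"
    and 0: "\<And>q. q \<in> S \<Longrightarrow> pd w f q = 0"
    and d: "pd v f differentiable at p"
  shows "pd w (pd v f) p = 0"
proof -
  obtain e where e: "e > 0" "ball p e \<subseteq> S" using S openE by blast
  \<comment> \<open>The radius is halved so that the whole segment from \<open>q\<close> to its
    translate stays in \<open>ball p e\<close>; along it the derivative of \<open>f\<close> is
    zero.\<close>
  have inv: "f (q + s *\<^sub>R w) = f q" if q: "q \<in> ball p (e/2)" and s: "norm (s *\<^sub>R w) < e/2" for q s
  proof -
    let ?g = "\<lambda>r. f (q + r *\<^sub>R (s *\<^sub>R w))"
    have "(?g has_derivative (\<lambda>h. 0)) (at r within {0..1})" if r: "r \<in> {0..1}" for r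
    proof -
      have "norm (r *\<^sub>R s *\<^sub>R w) \<le> norm (s *\<^sub>R w)"
        using r mult_right_mono[of r 1 "norm (s *\<^sub>R w)"] by (simp add: abs_mult mult.assoc)
      then have "q + r *\<^sub>R (s *\<^sub>R w) \<in> ball p e"
        using q s norm_triangle_ineq4[of "p - q" "r *\<^sub>R s *\<^sub>R w"]
        by (simp add: dist_norm algebra_simps)
      then have m: "q + r *\<^sub>R (s *\<^sub>R w) \<in> S" using e by auto
      have i: "((\<lambda>r. q + r *\<^sub>R (s *\<^sub>R w)) has_derivative (\<lambda>h. h *\<^sub>R (s *\<^sub>R w))) (at r within {0..1})"
        by (auto intro!: derivative_eq_intros)
      have "(?g has_derivative (\<lambda>h. pd (h *\<^sub>R (s *\<^sub>R w)) f (q + r *\<^sub>R (s *\<^sub>R w)))) (at r within {0..1})"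
        using diff_chain_within[OF i has_derivative_at_withinI[OF has_derivative_pd[OF f[OF m]]]]
        by (simp add: o_def)
      then show ?thesis using m f 0 by (simp add: pd_linear)
    qed
    from has_derivative_zero_unique[OF _ this, of 0 1] show ?thesis by simp
  qed
  have c: "pd v f (p + s *\<^sub>R w) = pd v f p" if s: "norm (s *\<^sub>R w) < e/2" for s
  proof -
    have m: "p + s *\<^sub>R w \<in> S" "p \<in> S" using s e by (auto intro!: subsetD[OF e(2)] simp: dist_norm)
    have i: "((\<lambda>q. q + s *\<^sub>R w) has_derivative (\<lambda>h. h)) (at p)"
      by (auto intro!: derivative_eq_intros)
    have "((\<lambda>q. f (q + s *\<^sub>R w)) has_derivative (\<lambda>h. pd h f (p + s *\<^sub>R w))) (at p)"
      using diff_chain_at[OF i has_derivative_pd[OF f[OF m(1)]]] by (simp add: o_def)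
    then have "(f has_derivative (\<lambda>h. pd h f (p + s *\<^sub>R w))) (at p)"
      by (rule has_derivative_transform_within_open[where s = "ball p (e/2)"])
         (use inv s e in auto)
    from pd_eqI[OF this] show ?thesis by simp
  qed
  have i: "((\<lambda>s. p + s *\<^sub>R w) has_derivative (\<lambda>h. h *\<^sub>R w)) (at (0::real))"
    by (auto intro!: derivative_eq_intros)
  have "((\<lambda>s. pd v f (p + s *\<^sub>R w)) has_derivative (\<lambda>h. pd (h *\<^sub>R w) (pd v f) p)) (at 0)"
    using diff_chain_at[OF i, of "pd v f"] has_derivative_pd[OF d] by (simp add: o_def)
  moreover have "((\<lambda>s. pd v f (p + s *\<^sub>R w)) has_derivative (\<lambda>h. 0)) (at 0)"
  proof (rule has_derivative_transform_within_open[OF has_derivative_const[of "pd v f p"]])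
    show "open {s::real. norm (s *\<^sub>R w) < e/2}" by (intro open_Collect_less continuous_intros)
  qed (use e c in auto)
  ultimately have "(\<lambda>h. pd (h *\<^sub>R w) (pd v f) p) = (\<lambda>h. 0)" by (rule has_derivative_unique)
  from fun_cong[OF this, of 1] show ?thesis by simp
qed

text \<open>Here \<open>pd v f\<close> is known through an expression \<open>g\<close>, from which
  it inherits differentiability at \<open>p\<close>.\<close>

lemma pd_pd_eq_0_cong:
  assumes S: "open S" "p \<in> S"
    and f: "\<And>q. q \<in> S \<Longrightarrow> f differentiable at q"
    and 0: "\<And>q. q \<in> S \<Longrightarrow> pd w f q = 0"
    and g: "\<And>q. q \<in> S \<Longrightarrow> pd v f q = g q" "g differentiable at p"
  shows "pd w g p = 0"
proof -
  have "pd v f differentiable at p"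
    using g(2) has_derivative_transform_within_open[OF _ S, of g _ UNIV "pd v f"] g(1)
    unfolding differentiable_def by metis
  from pd_pd_eq_0[OF S f 0 this] pd_cong[where v=w, OF S g(1)] show ?thesis by simp
qed

subsection \<open>Smooth functions\<close>

text \<open>Since \<open>S\<close> is open, equality on \<open>S\<close> passes to the derivatives
  at points of \<open>S\<close>. The induction generalises \<open>f\<close> and \<open>g\<close>
  because these derivatives are the next pair of functions.\<close>

lemma Ck_on_cong:
  assumes "open S" "\<And>x. x \<in> S \<Longrightarrow> f x = g x" "Ck_on k S f"
  shows "Ck_on k S g"
  using assms(2,3)
proof (induction k arbitrary: f g)
  case 0
  then show ?case using continuous_on_cong by auto
next
  case (Suc k)
  have d: "(g has_derivative frechet_derivative f (at x)) (at x)" if "x \<in> S" for x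
    using Suc.prems that frechet_derivative_works
    by (intro has_derivative_transform_within_open[of f _ x UNIV S g]) (auto simp: assms(1))
  then have e: "frechet_derivative g (at x) = frechet_derivative f (at x)" if "x \<in> S" for x
    using frechet_derivative_at that by metis
  have "Ck_on k S (\<lambda>x. frechet_derivative g (at x) v)" for v
    by (rule Suc.IH[of "\<lambda>x. frechet_derivative f (at x) v"]) (use Suc.prems e in auto)
  then show ?case using d by (auto simp: differentiable_def)
qed

lemma smooth_on_cong:
  "open S \<Longrightarrow> (\<And>x. x \<in> S \<Longrightarrow> f x = g x) \<Longrightarrow> smooth_on S f \<Longrightarrow> smooth_on S g"
  unfolding smooth_on_def using Ck_on_cong by blast

lemma smooth_on_differentiable: "smooth_on S f \<Longrightarrow> x \<in> S \<Longrightarrow> f differentiable at x"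
  unfolding smooth_on_def by (metis Ck_on.simps(2))

lemma smooth_on_continuous: "smooth_on S f \<Longrightarrow> continuous_on S f"
  unfolding smooth_on_def by (metis Ck_on.simps(1))

lemma smooth_on_frechet_derivative:
  "smooth_on S f \<Longrightarrow> smooth_on S (\<lambda>x. frechet_derivative f (at x) v)"
  unfolding smooth_on_def by (metis Ck_on.simps(2))

lemma smooth_on_pd: "smooth_on S f \<Longrightarrow> smooth_on S (pd v f)"
  using smooth_on_frechet_derivative[of S f v] unfolding pd_def[abs_def] by simp

lemma smooth_on_subset: "smooth_on S f \<Longrightarrow> T \<subseteq> S \<Longrightarrow> smooth_on T f"
proof -
  have "Ck_on k S f \<Longrightarrow> T \<subseteq> S \<Longrightarrow> Ck_on k T f" for k
    by (induction k arbitrary: f) (auto intro: continuous_on_subset)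
  then show "smooth_on S f \<Longrightarrow> T \<subseteq> S \<Longrightarrow> smooth_on T f" unfolding smooth_on_def by blast
qed

lemma smooth_on_bounded_linear:
  assumes L: "bounded_linear L" and S: "open S" and "smooth_on S f"
  shows "smooth_on S (\<lambda>x. L (f x))"
proof -
  have "Ck_on k S f \<Longrightarrow> Ck_on k S (\<lambda>x. L (f x))" for k
  proof (induction k arbitrary: f)
    case 0
    then show ?case using bounded_linear.continuous_on[OF L] by auto
  next
    case (Suc k)
    have d: "((\<lambda>x. L (f x)) has_derivative (\<lambda>v. L (frechet_derivative f (at x) v))) (at x)" if "x \<in> S" for x
      using Suc.prems that frechet_derivative_works
      by (intro bounded_linear.has_derivative[OF L]) auto
    then have e: "frechet_derivative (\<lambda>x. L (f x)) (at x) = (\<lambda>v. L (frechet_derivative f (at x) v))" if "x \<in> S" for x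
      using frechet_derivative_at that by metis
    have "Ck_on k S (\<lambda>x. frechet_derivative (\<lambda>x. L (f x)) (at x) v)" for v
      by (rule Ck_on_cong[OF S _ Suc.IH[of "\<lambda>x. frechet_derivative f (at x) v"]]) (use Suc.prems e in auto)
    then show ?case using d by (auto simp: differentiable_def)
  qed
  then show ?thesis using assms(3) unfolding smooth_on_def by blast
qed

lemma smooth_on_const: "smooth_on S (\<lambda>x. c)"
proof -
  have "Ck_on k S (\<lambda>x. c)" for k
    by (induction k arbitrary: c) auto
  then show ?thesis unfolding smooth_on_def by blast
qed

lemma smooth_on_affine:
  assumes L: "bounded_linear L"
  shows "smooth_on S (\<lambda>x. L x + c)"
proof -
  have d: "((\<lambda>x. L x + c) has_derivative L) (at x)" for x
    using has_derivative_add_const[OF bounded_linear_imp_has_derivative[OF L]] .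
  then have e: "frechet_derivative (\<lambda>x. L x + c) (at x) = L" for x
    using frechet_derivative_at by metis
  have "Ck_on k S (\<lambda>x. L x + c)" for k
  proof (cases k)
    case 0
    have "continuous_on S (\<lambda>x. L x + c)"
      using d has_derivative_continuous continuous_at_imp_continuous_on by blast
    then show ?thesis by (simp add: 0)
  next
    case (Suc k')
    show ?thesis using d smooth_on_const[of S] unfolding Suc smooth_on_def
      by (auto simp: e differentiable_def)
  qed
  then show ?thesis unfolding smooth_on_def by blast
qed

text \<open>The derivative in direction \<open>v\<close> is the derivative of \<open>f\<close> in
  the fixed direction \<open>L v\<close>, composed with the same affine map. So it has the same
  shape and the induction closes.\<close>

lemma smooth_on_compose_affine:
  fixes f :: "'a::euclidean_space \<Rightarrow> 'b::euclidean_space" and L :: "'c::euclidean_space \<Rightarrow> 'a"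
  assumes L: "bounded_linear L" and S: "open S" and "smooth_on S f" and T: "open T"
    and TS: "\<And>y. y \<in> T \<Longrightarrow> L y + c \<in> S"
  shows "smooth_on T (\<lambda>y. f (L y + c))"
proof -
  have "Ck_on k S f \<Longrightarrow> Ck_on k T (\<lambda>y. f (L y + c))" for k
  proof (induction k arbitrary: f)
    case 0
    have "continuous_on T (\<lambda>y. L y + c)"
      using smooth_on_continuous[OF smooth_on_affine[OF L]] .
    then show ?case using 0 TS by (auto intro!: continuous_on_compose2[of S f T "\<lambda>y. L y + c"])
  next
    case (Suc k)
    have i: "((\<lambda>x. L x + c) has_derivative L) (at x)" for x
      using has_derivative_add_const[OF bounded_linear_imp_has_derivative[OF L]] .
    have d: "((\<lambda>y. f (L y + c)) has_derivative (\<lambda>v. frechet_derivative f (at (L y + c)) (L v))) (at y)" if "y \<in> T" for y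
      using diff_chain_at[OF i, of f] Suc.prems TS[OF that] frechet_derivative_works
      by (force simp: o_def)
    then have e: "frechet_derivative (\<lambda>y. f (L y + c)) (at y) = (\<lambda>v. frechet_derivative f (at (L y + c)) (L v))" if "y \<in> T" for y
      using frechet_derivative_at that by metis
    have "Ck_on k T (\<lambda>y. frechet_derivative (\<lambda>y. f (L y + c)) (at y) v)" for v
      by (rule Ck_on_cong[OF T _ Suc.IH[of "\<lambda>x. frechet_derivative f (at x) (L v)"]]) (use Suc.prems e in auto)
    then show ?case using d by (auto simp: differentiable_def)
  qed
  then show ?thesis using assms(3) unfolding smooth_on_def by blast
qed

subsection \<open>Coordinates of the extended jet space\<close>

definition jt :: "extjet2 \<Rightarrow> real" where "jt p = fst (fst (fst p))"
definition jx :: "extjet2 \<Rightarrow> real" where "jx p = fst (snd (fst (fst p)))"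
definition ju :: "extjet2 \<Rightarrow> real" where "ju p = snd (snd (fst (fst p)))"
definition jut :: "extjet2 \<Rightarrow> real" where "jut p = fst (fst (snd (fst p)))"
definition jux :: "extjet2 \<Rightarrow> real" where "jux p = snd (fst (snd (fst p)))"
definition jutt :: "extjet2 \<Rightarrow> real" where "jutt p = fst (snd (snd (fst p)))"
definition jutx :: "extjet2 \<Rightarrow> real" where "jutx p = fst (snd (snd (snd (fst p))))"
definition juxx :: "extjet2 \<Rightarrow> real" where "juxx p = snd (snd (snd (snd (fst p))))"
definition jb :: "extjet2 \<Rightarrow> real" where "jb p = snd p"

lemmas coord_defs = jt_def jx_def ju_def jut_def jux_def jutt_def jutx_def juxx_def jb_def

text \<open>The basis dual to the coordinate functionals: \<open>pd et\<close> is the partial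
  derivative in t with all other jet variables and B held fixed, and likewise for the
  others.\<close>

definition et :: extjet2 where "et = (((1,0,0),(0,0),(0,0,0)),0)"
definition ex :: extjet2 where "ex = (((0,1,0),(0,0),(0,0,0)),0)"
definition eu :: extjet2 where "eu = (((0,0,1),(0,0),(0,0,0)),0)"
definition eut :: extjet2 where "eut = (((0,0,0),(1,0),(0,0,0)),0)"
definition eux :: extjet2 where "eux = (((0,0,0),(0,1),(0,0,0)),0)"
definition eutt :: extjet2 where "eutt = (((0,0,0),(0,0),(1,0,0)),0)"
definition eutx :: extjet2 where "eutx = (((0,0,0),(0,0),(0,1,0)),0)"
definition euxx :: extjet2 where "euxx = (((0,0,0),(0,0),(0,0,1)),0)"
definition eb :: extjet2 where "eb = (((0,0,0),(0,0),(0,0,0)),1)"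

lemmas evec_defs = et_def ex_def eu_def eut_def eux_def eutt_def eutx_def euxx_def eb_def

lemma extjet2_expand:
  "v = jt v *\<^sub>R et + jx v *\<^sub>R ex + ju v *\<^sub>R eu + jut v *\<^sub>R eut + jux v *\<^sub>R eux
     + jutt v *\<^sub>R eutt + jutx v *\<^sub>R eutx + juxx v *\<^sub>R euxx + jb v *\<^sub>R eb"
  by (simp add: coord_defs evec_defs prod_eq_iff)

lemma bounded_linear_coords:
  "bounded_linear jt" "bounded_linear jx" "bounded_linear ju" "bounded_linear jut"
  "bounded_linear jux" "bounded_linear jutt" "bounded_linear jutx" "bounded_linear juxx"
  "bounded_linear jb"
  unfolding coord_defs[abs_def] by (intro bounded_linear_intros)+

lemma has_derivative_coords:
  "(jt has_derivative jt) (at p)" "(jx has_derivative jx) (at p)" "(ju has_derivative ju) (at p)"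
  "(jut has_derivative jut) (at p)" "(jux has_derivative jux) (at p)"
  "(jutt has_derivative jutt) (at p)" "(jutx has_derivative jutx) (at p)"
  "(juxx has_derivative juxx) (at p)" "(jb has_derivative jb) (at p)"
  by (intro bounded_linear_imp_has_derivative bounded_linear_coords)+

lemma differentiable_coords:
  "jt differentiable (at p)" "jx differentiable (at p)" "ju differentiable (at p)"
  "jut differentiable (at p)" "jux differentiable (at p)" "jutt differentiable (at p)"
  "jutx differentiable (at p)" "juxx differentiable (at p)" "jb differentiable (at p)"
  using has_derivative_coords unfolding differentiable_def by blast+

lemma pd_coords:
  "pd v jt p = jt v" "pd v jx p = jx v" "pd v ju p = ju v" "pd v jut p = jut v"
  "pd v jux p = jux v" "pd v jutt p = jutt v" "pd v jutx p = jutx v" "pd v juxx p = juxx v"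
  "pd v jb p = jb v"
  by (rule pd_eqI[OF has_derivative_coords(1)] pd_eqI[OF has_derivative_coords(2)]
    pd_eqI[OF has_derivative_coords(3)] pd_eqI[OF has_derivative_coords(4)]
    pd_eqI[OF has_derivative_coords(5)] pd_eqI[OF has_derivative_coords(6)]
    pd_eqI[OF has_derivative_coords(7)] pd_eqI[OF has_derivative_coords(8)]
    pd_eqI[OF has_derivative_coords(9)])+

lemma coords_evecs:
  "jt et = 1" "jt ex = 0" "jt eu = 0" "jt eut = 0" "jt eux = 0" "jt eutt = 0" "jt eutx = 0" "jt euxx = 0" "jt eb = 0"
  "jx et = 0" "jx ex = 1" "jx eu = 0" "jx eut = 0" "jx eux = 0" "jx eutt = 0" "jx eutx = 0" "jx euxx = 0" "jx eb = 0"
  "ju et = 0" "ju ex = 0" "ju eu = 1" "ju eut = 0" "ju eux = 0" "ju eutt = 0" "ju eutx = 0" "ju euxx = 0" "ju eb = 0"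
  "jut et = 0" "jut ex = 0" "jut eu = 0" "jut eut = 1" "jut eux = 0" "jut eutt = 0" "jut eutx = 0" "jut euxx = 0" "jut eb = 0"
  "jux et = 0" "jux ex = 0" "jux eu = 0" "jux eut = 0" "jux eux = 1" "jux eutt = 0" "jux eutx = 0" "jux euxx = 0" "jux eb = 0"
  "jutt et = 0" "jutt ex = 0" "jutt eu = 0" "jutt eut = 0" "jutt eux = 0" "jutt eutt = 1" "jutt eutx = 0" "jutt euxx = 0" "jutt eb = 0"
  "jutx et = 0" "jutx ex = 0" "jutx eu = 0" "jutx eut = 0" "jutx eux = 0" "jutx eutt = 0" "jutx eutx = 1" "jutx euxx = 0" "jutx eb = 0"
  "juxx et = 0" "juxx ex = 0" "juxx eu = 0" "juxx eut = 0" "juxx eux = 0" "juxx eutt = 0" "juxx eutx = 0" "juxx euxx = 1" "juxx eb = 0"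
  "jb et = 0" "jb ex = 0" "jb eu = 0" "jb eut = 0" "jb eux = 0" "jb eutt = 0" "jb eutx = 0" "jb euxx = 0" "jb eb = 1"
  by (simp_all add: coord_defs evec_defs)

lemmas pd_simps = pd_const pd_add pd_diff pd_mult pd_power2 pd_coords coords_evecs
  differentiable_coords

subsection \<open>The determining equations\<close>

text \<open>
  \<open>T\<close>, \<open>X\<close>, \<open>U\<close>, \<open>\<beta>\<close> are the components of the transformation for \<open>t\<close>, \<open>x\<close>, \<open>u\<close>, \<open>B\<close>; \<open>P\<close>, \<open>Q\<close> are those
  for \<open>u_t\<close>, \<open>u_x\<close>, and \<open>A\<close>, \<open>G\<close>, \<open>C\<close> those for \<open>u_tt\<close>, \<open>u_tx\<close>, \<open>u_xx\<close>. The assumption \<open>eqn_ball\<close> is the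
  transformed equation, multiplied by \<open>u X_x\<close>, with \<open>B_x\<close> eliminated by means of the original
  equation; it is therefore an identity in all jet variables and \<open>B\<close>, and can be differentiated.
\<close>

locale determining =
  fixes S :: "extjet2 set" and \<epsilon> :: real and T X U P Q A G C \<beta> :: "extjet2 \<Rightarrow> real"
  assumes S: "open S"
    and smooth: "smooth_on S T" "smooth_on S X" "smooth_on S U" "smooth_on S P" "smooth_on S Q"
      "smooth_on S A" "smooth_on S G" "smooth_on S C" "smooth_on S \<beta>"
    and T0: "\<And>p w. p \<in> S \<Longrightarrow> w \<in> {eut, eux, eutt, eutx, euxx, eb} \<Longrightarrow> pd w T p = 0"
    and X0: "\<And>p w. p \<in> S \<Longrightarrow> w \<in> {et, eu, eut, eux, eutt, eutx, euxx, eb} \<Longrightarrow> pd w X p = 0"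
    and U0: "\<And>p w. p \<in> S \<Longrightarrow> w \<in> {eut, eux, eutt, eutx, euxx, eb} \<Longrightarrow> pd w U p = 0"
    and P0: "\<And>p w. p \<in> S \<Longrightarrow> w \<in> {eutt, eutx, euxx, eb} \<Longrightarrow> pd w P p = 0"
    and Q0: "\<And>p w. p \<in> S \<Longrightarrow> w \<in> {eutt, eutx, euxx, eb} \<Longrightarrow> pd w Q p = 0"
    and C0: "\<And>p. p \<in> S \<Longrightarrow> pd eb C p = 0"
    and \<beta>0: "\<And>p w. p \<in> S \<Longrightarrow> w \<in> {et, eu, eut, eux, eutt, eutx, euxx} \<Longrightarrow> pd w \<beta> p = 0"
    and contact_ball:
      "\<forall>p\<in>S. pd et U p + jut p * pd eu U p = P p * (pd et T p + jut p * pd eu T p)"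
      "\<forall>p\<in>S. pd ex U p + jux p * pd eu U p
         = P p * (pd ex T p + jux p * pd eu T p) + Q p * pd ex X p"
      "\<forall>p\<in>S. pd et P p + jut p * pd eu P p + jutt p * pd eut P p + jutx p * pd eux P p
         = A p * (pd et T p + jut p * pd eu T p)"
      "\<forall>p\<in>S. pd et Q p + jut p * pd eu Q p + jutt p * pd eut Q p + jutx p * pd eux Q p
         = G p * (pd et T p + jut p * pd eu T p)"
      "\<forall>p\<in>S. pd ex Q p + jux p * pd eu Q p + jutx p * pd eut Q p + juxx p * pd eux Q p
         = G p * (pd ex T p + jux p * pd eu T p) + C p * pd ex X p"
    and nz: "\<And>p. p \<in> S \<Longrightarrow> ju p \<noteq> 0" "\<And>p. p \<in> S \<Longrightarrow> pd ex X p \<noteq> 0" "\<And>p. p \<in> S \<Longrightarrow> pd eb \<beta> p \<noteq> 0"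
      "\<And>p. p \<in> S \<Longrightarrow> pd et T p * pd eu U p - pd eu T p * pd et U p \<noteq> 0" "\<epsilon> \<noteq> 0"
    and eqn_ball: "\<forall>p\<in>S. ju p * pd ex X p * P p = \<epsilon> * ju p * (pd ex X p * C p)
        + (pd ex \<beta> p * ju p + pd eb \<beta> p * (jut p - \<epsilon> * juxx p - jb p * jux p)) * U p
        + \<beta> p * ju p * (pd ex X p * Q p)"
begin

lemmas contact = contact_ball[rule_format]
lemmas eqn = eqn_ball[rule_format]

section \<open>Differentiability and vanishing mixed derivatives\<close>

lemma diff1 [simp]:
  assumes "p \<in> S"
  shows "T differentiable at p" "X differentiable at p" "U differentiable at p"
    "P differentiable at p" "Q differentiable at p" "A differentiable at p"
    "G differentiable at p" "C differentiable at p" "\<beta> differentiable at p"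
  using smooth assms smooth_on_differentiable by blast+

lemma diff2 [simp]:
  assumes "p \<in> S"
  shows "pd v T differentiable at p" "pd v X differentiable at p" "pd v U differentiable at p"
    "pd v Q differentiable at p" "pd v \<beta> differentiable at p"
    "pd w (pd v U) differentiable at p"
  using smooth assms smooth_on_differentiable smooth_on_pd by metis+

lemma pd_T0 [simp]: "p \<in> S \<Longrightarrow> w \<in> {eut, eux, eutt, eutx, euxx, eb} \<Longrightarrow> pd w (pd v T) p = 0"
  by (rule pd_pd_eq_0[OF S]) (auto simp: T0)

lemma pd_X0 [simp]: "p \<in> S \<Longrightarrow> w \<in> {et, eu, eut, eux, eutt, eutx, euxx, eb} \<Longrightarrow> pd w (pd v X) p = 0"
  by (rule pd_pd_eq_0[OF S]) (auto simp: X0)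

lemma pd_U0 [simp]: "p \<in> S \<Longrightarrow> w \<in> {eut, eux, eutt, eutx, euxx, eb} \<Longrightarrow> pd w (pd v U) p = 0"
  by (rule pd_pd_eq_0[OF S]) (auto simp: U0)

lemma pd_Q0 [simp]: "p \<in> S \<Longrightarrow> w \<in> {eutt, eutx, euxx, eb} \<Longrightarrow> pd w (pd v Q) p = 0"
  by (rule pd_pd_eq_0[OF S]) (auto simp: Q0)

lemma pd_\<beta>0 [simp]: "p \<in> S \<Longrightarrow> w \<in> {et, eu, eut, eux, eutt, eutx, euxx} \<Longrightarrow> pd w (pd v \<beta>) p = 0"
  by (rule pd_pd_eq_0[OF S]) (auto simp: \<beta>0)

lemmas calc = pd_simps T0 X0 U0 P0 Q0 C0 \<beta>0

text \<open>If the total t-derivative of \<open>T\<close> vanished, the contact condition would make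
  that of \<open>U\<close> vanish too, and (1, u_t) would be in the kernel of the Jacobian matrix of
  (\<open>T\<close>, \<open>U\<close>) in (t, u).\<close>

lemma Dt_T_nz: "p \<in> S \<Longrightarrow> pd et T p + jut p * pd eu T p \<noteq> 0"
proof
  assume p: "p \<in> S" and 0: "pd et T p + jut p * pd eu T p = 0"
  then have "pd et T p = - jut p * pd eu T p" "pd et U p = - jut p * pd eu U p"
    using contact(1)[OF p] by auto
  then show False using nz(4)[OF p] by simp
qed

text \<open>
  The equation is a bounded quantification because \<open>OF\<close> would otherwise instantiate the point by an
  unknown function of the bound variable; hence the facts named \<open>_ball\<close>.
\<close>

lemma pd_cong_S: "\<forall>q\<in>S. f q = g q \<Longrightarrow> p \<in> S \<Longrightarrow> pd v f p = pd v g p"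
  using pd_cong[OF S] by blast

text \<open>The transformed equation contains u_tt only through \<open>C\<close>, so
  \<open>C\<close> does not depend on it. The u_tt-derivatives of the contact conditions for
  \<open>Q\<close> then show that \<open>pd eut Q p\<close> times the total x-derivative of
  \<open>T\<close> is zero, and by the u_t-derivative of the second contact condition so is
  \<open>pd eut P p\<close> times the square of that total derivative.\<close>

lemma Dx_T_ball: "\<forall>p\<in>S. pd ex T p + jux p * pd eu T p = 0"
  (is "\<forall>p\<in>S. ?eq p")
proof
  fix p assume p: "p \<in> S"
  let ?D = "pd ex T p + jux p * pd eu T p" and ?E = "pd et T p + jut p * pd eu T p"
  have 1: "pd eu U p = pd eut P p * ?E + P p * pd eu T p"
    using pd_cong_S[where v=eut, OF contact_ball(1) p] p by (simp add: calc algebra_simps)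
  have 2: "pd eut P p * ?D + pd eut Q p * pd ex X p = 0"
    using pd_cong_S[where v=eut, OF contact_ball(2) p] p by (simp add: calc algebra_simps)
  have 4: "pd eut Q p = pd eutt G p * ?E"
    using pd_cong_S[where v=eutt, OF contact_ball(4) p] p by (simp add: calc algebra_simps)
  have C: "pd eutt C p = 0"
    using pd_cong_S[where v=eutt, OF eqn_ball p] p nz by (simp add: calc)
  have 5: "pd eutt G p * ?D = 0"
    using pd_cong_S[where v=eutt, OF contact_ball(5) p] p C by (simp add: calc algebra_simps)
  have "pd eut Q p * ?D = 0" using 4 5 by algebra
  then have "pd eut P p * ?D * ?D = 0" using 2 by algebra
  \<comment> \<open>Otherwise the derivatives of \<open>U\<close> in t and u would be
    \<open>P p\<close> times those of \<open>T\<close>, against the nonzero Jacobian.\<close>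
  moreover have "pd eut P p \<noteq> 0"
  proof
    assume "pd eut P p = 0"
    then have "pd eu U p = P p * pd eu T p" using 1 by simp
    moreover from this have "pd et U p = P p * pd et T p"
      using contact(1)[OF p] by (simp add: algebra_simps)
    ultimately show False using nz(4)[OF p] by simp
  qed
  ultimately show "?eq p" by simp
qed

lemmas Dx_T = Dx_T_ball[rule_format]

text \<open>\<open>T\<close> does not depend on u_x, so the vanishing total x-derivative can be
  split with respect to u_x.\<close>

lemma Tu: assumes p: "p \<in> S" shows "pd eu T p = 0"
  using pd_cong_S[where v=eux, OF Dx_T_ball p] p by (simp add: calc)

lemma Tx: assumes p: "p \<in> S" shows "pd ex T p = 0"
  using Dx_T[OF p] Tu[OF p] by simp

lemma pd_T0' [simp]: "p \<in> S \<Longrightarrow> w \<in> {ex, eu} \<Longrightarrow> pd w (pd v T) p = 0"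
  by (rule pd_pd_eq_0[OF S]) (auto simp: Tu Tx)

lemmas calc_T = calc Tu Tx

lemma Tt: "p \<in> S \<Longrightarrow> pd et T p \<noteq> 0"
  using Dt_T_nz[of p] Tu[of p] by simp

lemma Uu: "p \<in> S \<Longrightarrow> pd eu U p \<noteq> 0"
  using nz(4)[of p] Tu[of p] by auto

section \<open>First-order prolongation in explicit form\<close>

lemma P_T_t_ball: "\<forall>p\<in>S. P p * pd et T p = pd et U p + jut p * pd eu U p"
  (is "\<forall>p\<in>S. ?eq p")
proof
  fix p assume p: "p \<in> S"
  show "?eq p"
    using contact(1)[OF p] p by (simp add: Tu)
qed

lemmas P_T_t = P_T_t_ball[rule_format]

lemma Q_X_x_ball: "\<forall>p\<in>S. Q p * pd ex X p = pd ex U p + jux p * pd eu U p"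
  (is "\<forall>p\<in>S. ?eq p")
proof
  fix p assume p: "p \<in> S"
  show "?eq p"
    using contact(2)[OF p] p by (simp add: Tu Tx)
qed

lemmas Q_X_x = Q_X_x_ball[rule_format]

lemma P_ut: "p \<in> S \<Longrightarrow> pd eut P p * pd et T p = pd eu U p"
  using pd_cong_S[where v=eut and p=p, OF P_T_t_ball] by (simp add: calc_T)

lemma P_ux: "p \<in> S \<Longrightarrow> pd eux P p = 0"
  using pd_cong_S[where v=eux and p=p, OF P_T_t_ball] Tt[of p] by (simp add: calc_T)

lemma Q_ut: "p \<in> S \<Longrightarrow> pd eut Q p = 0"
  using pd_cong_S[where v=eut and p=p, OF Q_X_x_ball] nz(2)[of p] by (simp add: calc_T)

lemma Q_ux: "p \<in> S \<Longrightarrow> pd eux Q p * pd ex X p = pd eu U p"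
  using pd_cong_S[where v=eux and p=p, OF Q_X_x_ball] by (simp add: calc_T)

lemma C_X_x: "p \<in> S \<Longrightarrow> C p * pd ex X p = pd ex Q p + jux p * pd eu Q p + juxx p * pd eux Q p"
  using contact(5)[of p] by (simp add: Tu Tx Q_ut)

text \<open>The contact conditions eliminate \<open>C\<close>. Since \<open>Q\<close> depends
  neither on u_t nor on second derivatives, u_xx now enters only explicitly, and u_t only explicitly
  and through \<open>P\<close>.\<close>

lemma reduced_eqn_ball: "\<forall>p\<in>S. ju p * pd ex X p * P p = \<epsilon> * ju p * (pd ex Q p + jux p * pd eu Q p + juxx p * pd eux Q p)
        + (pd ex \<beta> p * ju p + pd eb \<beta> p * (jut p - \<epsilon> * juxx p - jb p * jux p)) * U p
        + \<beta> p * ju p * (pd ex U p + jux p * pd eu U p)"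
  (is "\<forall>p\<in>S. ?eq p")
proof
  fix p assume p: "p \<in> S"
  show "?eq p"
    using eqn[OF p] C_X_x[OF p] Q_X_x[OF p] by (simp add: mult.commute)
qed

lemmas reduced_eqn = reduced_eqn_ball[rule_format]

lemma pd_Q_ut [simp]: "p \<in> S \<Longrightarrow> pd eut (pd v Q) p = 0"
  by (rule pd_pd_eq_0[OF S]) (auto simp: Q_ut)

section \<open>Splitting with respect to u_t, u_xx, u_x and B\<close>

lemma eq_ut: assumes p: "p \<in> S" shows "ju p * pd ex X p * pd eu U p = pd eb \<beta> p * U p * pd et T p"
proof -
  have "ju p * pd ex X p * pd eut P p = pd eb \<beta> p * U p"
    using pd_cong_S[where v=eut, OF reduced_eqn_ball p] p by (simp add: calc_T Q_ut)
  then show ?thesis using P_ut[OF p] by (metis mult.assoc)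
qed

lemma eq_uxx_ball: "\<forall>p\<in>S. ju p * pd eu U p = pd eb \<beta> p * U p * pd ex X p"
  (is "\<forall>p\<in>S. ?eq p")
proof
  fix p assume p: "p \<in> S"
  have "ju p * pd eux Q p = pd eb \<beta> p * U p"
    using pd_cong_S[where v=euxx, OF reduced_eqn_ball p] p nz(5) by (simp add: calc_T algebra_simps)
  then show "?eq p" using Q_ux[OF p] by (metis mult.assoc)
qed

lemmas eq_uxx = eq_uxx_ball[rule_format]

lemma U_nz: "p \<in> S \<Longrightarrow> U p \<noteq> 0"
  using eq_uxx[of p] nz(1)[of p] Uu[of p] by auto

text \<open>Eliminating \<open>ju p * pd eu U p\<close> between the coefficients of u_t and u_xx
  leaves this difference times \<open>pd eb \<beta> p * U p\<close>, which is nonzero.\<close>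

lemma X_x_sq_ball: "\<forall>p\<in>S. pd et T p = (pd ex X p)\<^sup>2"
  (is "\<forall>p\<in>S. ?eq p")
proof
  fix p assume p: "p \<in> S"
  have "pd eb \<beta> p * U p * (pd et T p - (pd ex X p)\<^sup>2) = 0"
    using eq_ut[OF p] eq_uxx[OF p] by algebra
  then show "?eq p" using U_nz[OF p] nz(3)[OF p] by simp
qed

lemmas X_x_sq = X_x_sq_ball[rule_format]

text \<open>\<open>X\<close> depends on x only, which settles every direction but \<open>ex\<close>.
  For \<open>ex\<close>, \<open>X_x_sq\<close> is differentiated in x, and its left-hand side does
  not depend on x.\<close>

lemma pd_X_x: assumes p: "p \<in> S" and "v \<in> {et, ex, eu, eut, eux, eutt, eutx, euxx, eb}"
  shows "pd v (pd ex X) p = 0"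
  using pd_cong_S[where v=ex, OF X_x_sq_ball p] assms nz(2)[OF p] by (auto simp: calc_T)

lemma Q_x: "p \<in> S \<Longrightarrow> pd ex Q p * pd ex X p = pd ex (pd ex U) p + jux p * pd ex (pd eu U) p"
  using pd_cong_S[where v=ex and p=p, OF Q_X_x_ball] by (simp add: calc_T pd_X_x)

lemma Q_u: "p \<in> S \<Longrightarrow> pd eu Q p * pd ex X p = pd eu (pd ex U) p + jux p * pd eu (pd eu U) p"
  using pd_cong_S[where v=eu and p=p, OF Q_X_x_ball] by (simp add: calc_T)

text \<open>Multiplying by \<open>pd ex X p\<close> turns the derivatives of \<open>Q\<close> into
  derivatives of \<open>U\<close>, which do not involve u_x. As \<open>P\<close> does not either,
  the equation becomes an explicit quadratic polynomial in u_x.\<close>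

lemma expanded_eqn_ball: "\<forall>p\<in>S. ju p * pd ex X p * (P p * pd ex X p) =
      \<epsilon> * ju p * (pd ex (pd ex U) p + jux p * pd ex (pd eu U) p
        + jux p * (pd eu (pd ex U) p + jux p * pd eu (pd eu U) p) + juxx p * pd eu U p)
      + pd ex X p * (pd ex \<beta> p * ju p + pd eb \<beta> p * (jut p - \<epsilon> * juxx p - jb p * jux p)) * U p
      + pd ex X p * \<beta> p * ju p * (pd ex U p + jux p * pd eu U p)"
  (is "\<forall>p\<in>S. ?eq p")
proof
  fix p assume p: "p \<in> S"
  show "?eq p"
    using reduced_eqn[OF p] Q_x[OF p] Q_u[OF p] Q_ux[OF p] by algebra
qed

lemmas expanded_eqn = expanded_eqn_ball[rule_format]

lemma pd_pd_U0 [simp]: "p \<in> S \<Longrightarrow> w \<in> {eut, eux, eutt, eutx, euxx, eb} \<Longrightarrow> pd w (pd v (pd v' U)) p = 0"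
  by (rule pd_pd_eq_0[OF S]) auto

text \<open>Both orders of the mixed derivative of \<open>U\<close> in x and u are kept, so that
  their equality is not presupposed.\<close>

lemma eq_ux_ball: "\<forall>p\<in>S. 0 = \<epsilon> * ju p * (pd ex (pd eu U) p + pd eu (pd ex U) p + 2 * jux p * pd eu (pd eu U) p)
     - pd ex X p * pd eb \<beta> p * jb p * U p + pd ex X p * \<beta> p * ju p * pd eu U p"
  (is "\<forall>p\<in>S. ?eq p")
proof
  fix p assume p: "p \<in> S"
  show "?eq p"
    using pd_cong_S[where v=eux, OF expanded_eqn_ball p] p by (simp add: calc_T P_ux pd_X_x algebra_simps)
qed

lemmas eq_ux = eq_ux_ball[rule_format]

lemma U_uu: assumes p: "p \<in> S" shows "pd eu (pd eu U) p = 0"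
  using pd_cong_S[where v=eux, OF eq_ux_ball p] p nz by (simp add: calc_T pd_X_x)

text \<open>Since \<open>pd eu U\<close> does not depend on u, the u-derivative of
  \<open>eq_uxx\<close> has the factor \<open>pd eu U p\<close> on both sides, and it
  cancels.\<close>

lemma \<beta>_b_ball: "\<forall>p\<in>S. pd eb \<beta> p * pd ex X p = 1"
  (is "\<forall>p\<in>S. ?eq p")
proof
  fix p assume p: "p \<in> S"
  have "pd eu U p = pd eb \<beta> p * pd eu U p * pd ex X p"
    using pd_cong_S[where v=eu, OF eq_uxx_ball p] p by (simp add: calc_T pd_X_x U_uu)
  then show "?eq p" using Uu[OF p] by (simp add: field_simps)
qed

lemmas \<beta>_b = \<beta>_b_ball[rule_format]

lemma U_eq: "p \<in> S \<Longrightarrow> U p = ju p * pd eu U p"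
  using eq_uxx[of p] \<beta>_b[of p] by (metis mult.commute mult.left_commute mult.right_neutral)

lemma pd_\<beta>_b: assumes p: "p \<in> S" and v: "v \<in> {et, ex, eu, eut, eux, eutt, eutx, euxx, eb}"
  shows "pd v (pd eb \<beta>) p = 0"
  using pd_cong_S[where v=v, OF \<beta>_b_ball p] p nz(2)[OF p] by (simp add: calc_T pd_X_x[OF p v])

lemma \<beta>_xb: assumes p: "p \<in> S" shows "pd eb (pd ex \<beta>) p = 0"
proof -
  \<comment> \<open>The commutation lemma needs a function with zero derivative in B. By
    \<open>\<beta>_b\<close> subtracting \<open>jb\<close> achieves this, and the x-derivative is
    that of \<open>\<beta>\<close> up to the locally constant factor \<open>pd ex X\<close>.\<close>
  let ?f = "\<lambda>q. \<beta> q * pd ex X q - jb q" and ?g = "\<lambda>q. pd ex \<beta> q * pd ex X q"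
  have "pd eb ?g p = 0"
  proof (rule pd_pd_eq_0_cong[OF S p, of ?f])
    show "pd eb ?f q = 0" "pd ex ?f q = ?g q" if "q \<in> S" for q
      using that by (simp_all add: calc_T \<beta>_b pd_X_x)
  qed (use p in \<open>simp_all add: differentiable_coords\<close>)
  then show ?thesis using p nz(2)[OF p] by (simp add: calc_T pd_X_x)
qed

text \<open>In the B-derivative of the expanded equation the terms with u_x cancel by
  \<open>U_eq\<close>, leaving \<open>ju p * pd ex U p\<close>.\<close>

lemma U_x0_ball: "\<forall>p\<in>S. pd ex U p = 0"
  (is "\<forall>p\<in>S. ?eq p")
proof
  fix p assume p: "p \<in> S"
  have "ju p * pd ex U p + (jux p * ju p * pd eu U p  - jux p * U p) = 0"
    using pd_cong_S[where v=eb, OF expanded_eqn_ball p] p nz(2,3)[OF p]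
    by (simp add: calc_T pd_X_x pd_\<beta>_b \<beta>_xb)  algebra
  then show "?eq p" using U_eq[OF p] nz(1)[OF p] by simp
qed

lemmas U_x0 = U_x0_ball[rule_format]

lemma pd_U_x [simp]: assumes p: "p \<in> S" shows "pd ex (pd v U) p = 0"
  by (rule pd_pd_eq_0[OF S]) (auto simp: U_x0 p)

lemma pd_U_x' [simp]: assumes p: "p \<in> S" shows "pd v (pd ex U) p = 0"
  using pd_cong_S[where v=v, OF U_x0_ball p] by (simp add: pd_const)

text \<open>With the second derivatives of \<open>U\<close> in x and u gone, the u_x-coefficient is
  \<open>\<beta> p * pd ex X p - jb p\<close> times the nonzero \<open>U p\<close>.\<close>

lemma \<beta>_eq_ball: "\<forall>p\<in>S. \<beta> p * pd ex X p = jb p"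
  (is "\<forall>p\<in>S. ?eq p")
proof
  fix p assume p: "p \<in> S"
  have "0 = (\<beta> p * pd ex X p) * (ju p * pd eu U p) - (pd eb \<beta> p * pd ex X p) * jb p * U p"
    using eq_ux[OF p] by (simp add: U_uu p algebra_simps)
  then have "(\<beta> p * pd ex X p - jb p) * U p = 0"
    by (simp only: \<beta>_b[OF p] U_eq[OF p, symmetric]) (simp add: left_diff_distrib)
  then show "?eq p" using U_nz[OF p] by simp
qed

lemmas \<beta>_eq = \<beta>_eq_ball[rule_format]

text \<open>In what remains of the expanded equation the terms with u_xx and with u_x cancel.
  Comparing the result with \<open>P_T_t\<close> then shows that \<open>U\<close> does not depend on
  t.\<close>

lemma P_eq_ball: "\<forall>p\<in>S. P p * (pd ex X p)\<^sup>2 = jut p * pd eu U p"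
  (is "\<forall>p\<in>S. ?eq p")
proof
  fix p assume p: "p \<in> S"
  have x: "pd ex \<beta> p = 0"
    using pd_cong_S[where v=ex, OF \<beta>_eq_ball p] p nz(2)[OF p] by (simp add: calc_T pd_X_x)
  have "ju p * (P p * (pd ex X p)\<^sup>2) = \<epsilon> * juxx p * (ju p * pd eu U p)
      + (pd eb \<beta> p * pd ex X p) * (jut p - \<epsilon> * juxx p - jb p * jux p) * U p
      + (\<beta> p * pd ex X p) * jux p * (ju p * pd eu U p)"
    using expanded_eqn[OF p] by (simp add: U_uu p x U_x0 power2_eq_square algebra_simps)
  then have "ju p * (P p * (pd ex X p)\<^sup>2) = jut p * U p"
    by (simp only: \<beta>_b[OF p] \<beta>_eq[OF p] U_eq[OF p, symmetric]) (simp add: algebra_simps)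
  then have "ju p * (P p * (pd ex X p)\<^sup>2) = ju p * (jut p * pd eu U p)"
    using U_eq[OF p] by simp
  then show "?eq p" using nz(1)[OF p] by simp
qed

lemmas P_eq = P_eq_ball[rule_format]

lemma U_t0: "p \<in> S \<Longrightarrow> pd et U p = 0"
  using P_eq[of p] P_T_t[of p] X_x_sq[of p] by simp

lemma pd_U_u: assumes p: "p \<in> S" and "v \<in> {et, ex, eu, eut, eux, eutt, eutx, euxx, eb}"
  shows "pd v (pd eu U) p = 0"
proof -
  have "pd et (pd eu U) p = 0" by (rule pd_pd_eq_0[OF S]) (auto simp: U_t0 p)
  then show ?thesis using assms U_uu[OF p] by auto
qed

section \<open>Components for u_x and for the second derivatives\<close>

lemma Q_eq_ball: "\<forall>p\<in>S. Q p * pd ex X p = jux p * pd eu U p"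
  (is "\<forall>p\<in>S. ?eq p")
proof
  fix p assume p: "p \<in> S"
  show "?eq p"
    using Q_X_x[OF p] U_x0[OF p] by simp
qed

lemmas Q_eq = Q_eq_ball[rule_format]

lemma C_eq: assumes p: "p \<in> S" shows "C p * (pd ex X p)\<^sup>2 = juxx p * pd eu U p"
proof -
  have "pd ex Q p = 0" "pd eu Q p = 0"
    using Q_x[OF p] Q_u[OF p] p nz(2)[OF p] U_uu[OF p] by auto
  then have "C p * pd ex X p = juxx p * pd eux Q p" using C_X_x[OF p] by simp
  then show ?thesis using Q_ux[OF p] by algebra
qed

lemma G_eq: assumes p: "p \<in> S" shows "G p * (pd ex X p) ^ 3 = jutx p * pd eu U p"
proof -
  have "pd eu Q p = 0" using Q_u[OF p] p nz(2)[OF p] U_uu[OF p] by auto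
  moreover have "pd et Q p = 0"
    using pd_cong_S[where v=et, OF Q_eq_ball p] p nz(2)[OF p] by (simp add: calc_T pd_U_u)
  ultimately have "jutx p * pd eux Q p = G p * (pd ex X p)\<^sup>2"
    using contact(4)[OF p] Q_ut[OF p] Tu[OF p] X_x_sq[OF p] by simp
  then show ?thesis using Q_ux[OF p] by algebra
qed

lemma A_eq: assumes p: "p \<in> S" shows "A p * (pd ex X p) ^ 4 = jutt p * pd eu U p"
proof -
  have "pd eu P p = 0" "pd et P p = 0"
    using pd_cong_S[where v=eu, OF P_eq_ball p] pd_cong_S[where v=et, OF P_eq_ball p] p nz(2)[OF p]
    by (simp_all add: calc_T pd_U_u pd_X_x)
  then have "jutt p * pd eut P p = A p * (pd ex X p)\<^sup>2"
    using contact(3)[OF p] Tu[OF p] X_x_sq[OF p] P_ux[OF p] by simp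
  then show ?thesis using P_ut[OF p] X_x_sq[OF p] by algebra
qed

end

section \<open>Coordinate forms of the definitions, and passage from local to global
  identities\<close>

lemma extjet2_eqI:
  assumes "jt p = jt q" "jx p = jx q" "ju p = ju q" "jut p = jut q" "jux p = jux q"
    "jutt p = jutt q" "jutx p = jutx q" "juxx p = juxx q" "jb p = jb q"
  shows "p = q"
  using assms by (simp add: coord_defs prod_eq_iff)

lemma coords_linear:
  "jt (p + q) = jt p + jt q" "jx (p + q) = jx p + jx q" "ju (p + q) = ju p + ju q"
  "jut (p + q) = jut p + jut q" "jux (p + q) = jux p + jux q" "jutt (p + q) = jutt p + jutt q"
  "jutx (p + q) = jutx p + jutx q" "juxx (p + q) = juxx p + juxx q" "jb (p + q) = jb p + jb q"
  "jt (r *\<^sub>R p) = r * jt p" "jx (r *\<^sub>R p) = r * jx p" "ju (r *\<^sub>R p) = r * ju p"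
  "jut (r *\<^sub>R p) = r * jut p" "jux (r *\<^sub>R p) = r * jux p" "jutt (r *\<^sub>R p) = r * jutt p"
  "jutx (r *\<^sub>R p) = r * jutx p" "juxx (r *\<^sub>R p) = r * juxx p" "jb (r *\<^sub>R p) = r * jb p"
  by (simp_all add: coord_defs)

lemma cartan_iff:
  "fst h \<in> cartan (fst p) \<longleftrightarrow> ju h = jut p * jt h + jux p * jx h \<and>
     jut h = jutt p * jt h + jutx p * jx h \<and> jux h = jutx p * jt h + juxx p * jx h"
proof -
  obtain t x u ut ux utt utx uxx b where p: "p = (((t,x,u),(ut,ux),(utt,utx,uxx)),b)"
    by (metis surj_pair)
  obtain t' x' u' ut' ux' utt' utx' uxx' b' where h: "h = (((t',x',u'),(ut',ux'),(utt',utx',uxx')),b')"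
    by (metis surj_pair)
  show ?thesis by (auto simp: p h coord_defs)
qed

lemma fokker_planck_class_iff:
  "fst p \<in> fokker_planck_class \<epsilon> I B \<longleftrightarrow>
     jx p \<in> I \<and> jut p = \<epsilon> * juxx p + (deriv B (jx p) * ju p + B (jx p) * jux p)"
proof -
  obtain t x u ut ux utt utx uxx b where p: "p = (((t,x,u),(ut,ux),(utt,utx,uxx)),b)"
    by (metis surj_pair)
  show ?thesis by (auto simp: p coord_defs fokker_planck_class_def)
qed

lemma preserves_class_iff:
  "preserves_class E D \<Phi> \<longleftrightarrow>
     (\<forall>I B. open I \<and> smooth_on I B \<longrightarrow>
        (\<exists>J B'. open J \<and> smooth_on J B' \<and>
           (\<forall>p\<in>D. jx p \<in> I \<and> jb p = B (jx p) \<longrightarrow>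
              jx (\<Phi> p) \<in> J \<and> jb (\<Phi> p) = B' (jx (\<Phi> p)) \<and>
              (fst p \<in> E I B \<longleftrightarrow> fst (\<Phi> p) \<in> E J B'))))"
proof -
  have "(\<forall>z. xcoord z \<in> I \<and> (z, B (xcoord z)) \<in> D \<longrightarrow>
         (let (z', b') = \<Phi> (z, B (xcoord z)) in
            xcoord z' \<in> J \<and> b' = B' (xcoord z') \<and> (z \<in> E I B \<longleftrightarrow> z' \<in> E J B'))) \<longleftrightarrow>
      (\<forall>p\<in>D. jx p \<in> I \<and> jb p = B (jx p) \<longrightarrow>
         jx (\<Phi> p) \<in> J \<and> jb (\<Phi> p) = B' (jx (\<Phi> p)) \<and> (fst p \<in> E I B \<longleftrightarrow> fst (\<Phi> p) \<in> E J B'))"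
    for I B J B'
  proof -
    have "jx p = xcoord (fst p)" "jb p = snd p" for p by (simp_all add: coord_defs xcoord_def)
    then show ?thesis unfolding Ball_def Let_def case_prod_beta by (metis prod.collapse fst_conv snd_conv)
  qed
  then show ?thesis unfolding preserves_class_def by presburger
qed

text \<open>The line through \<open>p\<close> in direction \<open>w\<close> stays in one fibre of
  \<open>g\<close>, on which \<open>f\<close> is constant. This turns projectability into vanishing
  partial derivatives.\<close>

lemma pd_eq_0_fibre:
  assumes D: "open D" "p \<in> D" and f: "f differentiable at p"
    and fibre: "\<And>q. q \<in> D \<Longrightarrow> g q = g p \<Longrightarrow> f q = f p"
    and g: "\<And>s. g (p + s *\<^sub>R w) = g p"
  shows "pd w f p = 0"
proof -
  have i: "((\<lambda>s. p + s *\<^sub>R w) has_derivative (\<lambda>h. h *\<^sub>R w)) (at (0::real))"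
    by (auto intro!: derivative_eq_intros)
  have "((\<lambda>s. f (p + s *\<^sub>R w)) has_derivative (\<lambda>h. pd (h *\<^sub>R w) f p)) (at 0)"
    using diff_chain_at[OF i, of f] has_derivative_pd[OF f] by (simp add: o_def)
  moreover have "((\<lambda>s. f (p + s *\<^sub>R w)) has_derivative (\<lambda>h. 0)) (at 0)"
  proof (rule has_derivative_transform_within_open[OF has_derivative_const[of "f p"]])
    show "open ((\<lambda>s::real. p + s *\<^sub>R w) -` D)"
      by (intro open_vimage D continuous_intros)
  qed (use D fibre[OF _ g] in auto)
  ultimately have "(\<lambda>h. pd (h *\<^sub>R w) f p) = (\<lambda>h. 0)" by (rule has_derivative_unique)
  from fun_cong[OF this, of 1] show ?thesis by simp
qed

lemma pd_expand:
  assumes f: "f differentiable at p"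
  shows "pd v f p = jt v * pd et f p + jx v * pd ex f p + ju v * pd eu f p + jut v * pd eut f p
     + jux v * pd eux f p + jutt v * pd eutt f p + jutx v * pd eutx f p + juxx v * pd euxx f p
     + jb v * pd eb f p"
  by (subst extjet2_expand[of v]) (simp only: pd_linear[OF f])

lemma constant_if_pd_eq_0:
  assumes D: "open D" "connected D" and f: "\<And>q. q \<in> D \<Longrightarrow> f differentiable at q"
    and 0: "\<And>q v. q \<in> D \<Longrightarrow> v \<in> {et, ex, eu, eut, eux, eutt, eutx, euxx, eb} \<Longrightarrow> pd v f q = 0"
    and "p \<in> D" "q \<in> D"
  shows "f p = f q"
proof (rule has_derivative_zero_unique_connected[OF D _ \<open>p \<in> D\<close> \<open>q \<in> D\<close>])
  fix q assume q: "q \<in> D"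
  have "(\<lambda>v. pd v f q) = (\<lambda>v. 0)" using pd_expand[OF f[OF q]] 0[OF q] by (intro ext) simp
  then show "(f has_derivative (\<lambda>v. 0)) (at q)" using has_derivative_pd[OF f[OF q]] by simp
qed

text \<open>A point with u = 0 is the limit of the points \<open>p + s *\<^sub>R eu\<close> with
  nonzero \<open>s\<close>, where the two functions agree.\<close>

lemma eq_by_density:
  fixes f g :: "extjet2 \<Rightarrow> real"
  assumes D: "open D" "p \<in> D" and c: "continuous_on D f" "continuous_on D g"
    and eq: "\<And>q. q \<in> D \<Longrightarrow> ju q \<noteq> 0 \<Longrightarrow> f q = g q"
  shows "f p = g p"
proof (cases "ju p = 0")
  case True
  let ?q = "\<lambda>s::real. p + s *\<^sub>R eu"
  have "((\<lambda>s. p + s *\<^sub>R eu) \<longlongrightarrow> p + 0 *\<^sub>R eu) (at 0)" by (intro tendsto_intros)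
  then have lim: "(?q \<longlongrightarrow> p) (at 0)" by simp
  have "isCont (\<lambda>q. f q - g q) p"
    using c D by (intro continuous_intros) (simp_all add: continuous_on_eq_continuous_at)
  then have 1: "((\<lambda>s. f (?q s) - g (?q s)) \<longlongrightarrow> f p - g p) (at 0)"
    using lim isCont_tendsto_compose by blast
  have "\<forall>\<^sub>F s in at 0. ?q s \<in> D" using lim D topological_tendstoD by blast
  moreover have "\<forall>\<^sub>F s::real in at 0. s \<noteq> 0" by (simp add: eventually_at_filter)
  ultimately have "\<forall>\<^sub>F s in at 0. f (?q s) - g (?q s) = 0"
    by eventually_elim (use eq True in \<open>simp add: coords_linear coords_evecs\<close>)
  then have "((\<lambda>s. f (?q s) - g (?q s)) \<longlongrightarrow> 0) (at 0)" by (rule tendsto_eventually)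
  from tendsto_unique[OF _ 1 this] show ?thesis by simp
qed (use eq D in auto)

subsection \<open>Equivalence transformations satisfy the determining equations\<close>

locale symmetry =
  fixes \<epsilon> :: real and D :: "extjet2 set" and \<Phi> :: "extjet2 \<Rightarrow> extjet2"
  assumes eps: "\<epsilon> \<noteq> 0" and in_group: "(D, \<Phi>) \<in> equivalence_group (fokker_planck_class \<epsilon>)"
begin

lemma D: "open D" "connected D" "D \<noteq> {}"
  using in_group by (auto simp: equivalence_group_def transformation_domain_def)

lemma smooth_\<Phi>: "smooth_on D \<Phi>"
  using in_group by (auto simp: equivalence_group_def diffeomorphism_on_def)

definition "T p = jt (\<Phi> p)"
definition "X p = jx (\<Phi> p)"
definition "U p = ju (\<Phi> p)"
definition "P p = jut (\<Phi> p)"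
definition "Q p = jux (\<Phi> p)"
definition "A p = jutt (\<Phi> p)"
definition "G p = jutx (\<Phi> p)"
definition "C p = juxx (\<Phi> p)"
definition "\<beta> p = jb (\<Phi> p)"

lemmas comp_defs = T_def X_def U_def P_def Q_def A_def G_def C_def \<beta>_def

lemma smooth: "smooth_on D T" "smooth_on D X" "smooth_on D U" "smooth_on D P" "smooth_on D Q"
      "smooth_on D A" "smooth_on D G" "smooth_on D C" "smooth_on D \<beta>"
  unfolding comp_defs[abs_def]
  by (rule bounded_linear_coords[THEN smooth_on_bounded_linear, OF D(1) smooth_\<Phi>])+

lemma diff:
  assumes "p \<in> D"
  shows "T differentiable at p" "X differentiable at p" "U differentiable at p"
    "P differentiable at p" "Q differentiable at p" "A differentiable at p"
    "G differentiable at p" "C differentiable at p" "\<beta> differentiable at p"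
  using smooth assms smooth_on_differentiable by blast+

definition "d\<Phi> p = frechet_derivative \<Phi> (at p)"

lemma d\<Phi>: "p \<in> D \<Longrightarrow> (\<Phi> has_derivative d\<Phi> p) (at p)"
  unfolding d\<Phi>_def using smooth_on_differentiable[OF smooth_\<Phi>] frechet_derivative_works by blast

lemma coords_d\<Phi>:
  assumes p: "p \<in> D"
  shows "jt (d\<Phi> p v) = pd v T p" "jx (d\<Phi> p v) = pd v X p" "ju (d\<Phi> p v) = pd v U p"
    "jut (d\<Phi> p v) = pd v P p" "jux (d\<Phi> p v) = pd v Q p" "jutt (d\<Phi> p v) = pd v A p"
    "jutx (d\<Phi> p v) = pd v G p" "juxx (d\<Phi> p v) = pd v C p" "jb (d\<Phi> p v) = pd v \<beta> p"
  unfolding comp_defs[abs_def]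
  by (rule bounded_linear_coords[THEN bounded_linear.has_derivative, OF d\<Phi>[OF p], THEN pd_eqI, symmetric])+

text \<open>The chain rule for the smooth left inverse gives injectivity; a linear injection of a
  finite-dimensional space into itself is onto.\<close>

lemma bij_d\<Phi>: assumes p: "p \<in> D" shows "inj (d\<Phi> p)" "surj (d\<Phi> p)"
proof -
  obtain \<Psi> where o: "open (\<Phi> ` D)" and \<Psi>: "smooth_on (\<Phi> ` D) \<Psi>" "\<And>q. q \<in> D \<Longrightarrow> \<Psi> (\<Phi> q) = q"
    using in_group by (auto simp: equivalence_group_def diffeomorphism_on_def)
  obtain \<Psi>' where "(\<Psi> has_derivative \<Psi>') (at (\<Phi> p))"
    using smooth_on_differentiable[OF \<Psi>(1), of "\<Phi> p"] p unfolding differentiable_def by auto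
  from diff_chain_at[OF d\<Phi>[OF p] this] have "(\<Psi> \<circ> \<Phi> has_derivative \<Psi>' \<circ> d\<Phi> p) (at p)" .
  then have "((\<lambda>q. q) has_derivative \<Psi>' \<circ> d\<Phi> p) (at p)"
    by (rule has_derivative_transform_within_open[OF _ D(1) p]) (simp add: \<Psi>)
  then have "\<Psi>' \<circ> d\<Phi> p = (\<lambda>v. v)" using has_derivative_unique has_derivative_ident by blast
  then show i: "inj (d\<Phi> p)" by (metis inj_on_id2 inj_on_imageI2)
  show "surj (d\<Phi> p)"
    using linear_injective_imp_surjective[OF _ i] d\<Phi>[OF p] has_derivative_linear by blast
qed

section \<open>Consequences of projectability and contact consistency\<close>

lemma base0:
  assumes p: "p \<in> D" and w: "w \<in> {eut, eux, eutt, eutx, euxx, eb}"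
  shows "pd w T p = 0" "pd w X p = 0" "pd w U p = 0"
proof -
  obtain \<phi> where \<phi>: "\<And>q. q \<in> D \<Longrightarrow> base_of (\<Phi> q) = \<phi> (base_of q)"
    using in_group by (auto simp: equivalence_group_def projectable_def)
  have w': "base_of (p + s *\<^sub>R w) = base_of p" for s
    using w by (auto simp: base_of_def evec_defs zero_prod_def)
  have c: "T q = fst (base_of (\<Phi> q))" "X q = fst (snd (base_of (\<Phi> q)))" "U q = snd (snd (base_of (\<Phi> q)))" for q
    by (simp_all add: comp_defs coord_defs base_of_def)
  show "pd w T p = 0" "pd w X p = 0" "pd w U p = 0"
    by (rule pd_eq_0_fibre[OF D(1) p _ _ w'], use \<phi> p c diff in \<open>simp_all\<close>)+
qed

lemma jet0:
  assumes p: "p \<in> D"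
  shows "pd eb P p = 0" "pd eb Q p = 0" "pd eb A p = 0" "pd eb G p = 0" "pd eb C p = 0"
proof -
  obtain \<psi> where \<psi>: "\<And>q. q \<in> D \<Longrightarrow> fst (\<Phi> q) = \<psi> (fst q)"
    using in_group by (auto simp: equivalence_group_def projectable_def)
  have w': "fst (p + s *\<^sub>R eb) = fst p" for s
    by (simp add: evec_defs zero_prod_def)
  show "pd eb P p = 0" "pd eb Q p = 0" "pd eb A p = 0" "pd eb G p = 0" "pd eb C p = 0"
    by (rule pd_eq_0_fibre[OF D(1) p _ _ w'], use \<psi> p diff in \<open>simp_all add: comp_defs coord_defs\<close>)+
qed

text \<open>The hypotheses say that \<open>h\<close> lies in the Cartan distribution at
  \<open>p\<close>. This covers the truncated total derivatives as well as directions changing only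
  second derivatives.\<close>

lemma contact:
  assumes p: "p \<in> D" and h: "ju h = jut p * jt h + jux p * jx h"
    "jut h = jutt p * jt h + jutx p * jx h" "jux h = jutx p * jt h + juxx p * jx h"
  shows "pd h U p = P p * pd h T p + Q p * pd h X p"
    "pd h P p = A p * pd h T p + G p * pd h X p"
    "pd h Q p = G p * pd h T p + C p * pd h X p"
proof -
  have "contact_consistent D \<Phi>" using in_group by (auto simp: equivalence_group_def)
  moreover have "fst h \<in> cartan (fst p)" using h cartan_iff by blast
  ultimately have "fst (d\<Phi> p (fst h, snd h)) \<in> cartan (fst (\<Phi> p))"
    using p unfolding contact_consistent_def d\<Phi>_def by blast
  then show "pd h U p = P p * pd h T p + Q p * pd h X p"
    "pd h P p = A p * pd h T p + G p * pd h X p"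
    "pd h Q p = G p * pd h T p + C p * pd h X p"
    unfolding prod.collapse cartan_iff coords_d\<Phi>[OF p] by (simp_all add: comp_defs)
qed

text \<open>
  Through a given point of \<open>D\<close> passes the affine arbitrary element with any prescribed slope \<open>m\<close>;
  \<open>k\<close> is the slope of its image.
\<close>

lemma slope:
  assumes p: "p \<in> D"
  shows "\<exists>k. (\<forall>w \<in> {et, eu, eut, eux, eutt, eutx, euxx}. pd w \<beta> p = k * pd w X p) \<and>
    pd ex \<beta> p + m * pd eb \<beta> p = k * pd ex X p \<and>
    (jut p = \<epsilon> * juxx p + (m * ju p + jb p * jux p) \<longrightarrow>
       P p = \<epsilon> * C p + (k * U p + \<beta> p * Q p))"
proof -
  define B where "B x = m * x + (jb p - m * jx p)" for x
  have dB: "(B has_real_derivative m) (at x)" for x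
    unfolding B_def[abs_def] by (auto intro!: derivative_eq_intros)
  have "smooth_on UNIV B"
    unfolding B_def[abs_def] by (intro smooth_on_affine bounded_linear_intros)
  then obtain J B' where J: "open J" and B': "smooth_on J B'"
    and *: "\<And>q. q \<in> D \<Longrightarrow> jb q = B (jx q) \<Longrightarrow> X q \<in> J \<and> \<beta> q = B' (X q) \<and>
        (fst q \<in> fokker_planck_class \<epsilon> UNIV B \<longleftrightarrow> fst (\<Phi> q) \<in> fokker_planck_class \<epsilon> J B')"
    using in_group unfolding equivalence_group_def preserves_class_iff comp_defs
    by (simp del: fst_conv) (metis UNIV_I open_UNIV)
  have Bp: "B (jx p) = jb p" by (simp add: B_def)
  have Xp: "X p \<in> J" "\<beta> p = B' (X p)" using * p Bp by auto
  define k where "k = deriv B' (X p)"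
  have dB': "(B' has_real_derivative k) (at (X p))"
    using smooth_on_differentiable[OF B' Xp(1)] unfolding k_def
    by (simp add: DERIV_deriv_iff_real_differentiable)
  \<comment> \<open>\<open>F\<close> moves a point along the B-axis onto the graph of
    \<open>B\<close> and fixes \<open>p\<close>. Composing with \<open>F\<close> turns the relation
    between \<open>\<beta>\<close> and \<open>X\<close>, available only on the graph, into an
    identity on an open set that can be differentiated.\<close>
  define F where "F q = (fst q, B (jx q))" for q :: extjet2
  have Fp: "F p = p" by (simp add: F_def Bp jb_def)
  have dF: "(F has_derivative (\<lambda>h. (fst h, m * jx h))) (at p)"
    unfolding F_def[abs_def] B_def by (auto intro!: derivative_eq_intros has_derivative_coords)
  have "continuous_on UNIV jx"
    by (rule linear_continuous_on) (rule bounded_linear_coords)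
  then have "continuous_on UNIV F" unfolding F_def[abs_def] B_def by (intro continuous_intros)
  then have o: "open (F -` D)" using D(1) open_vimage by blast
  have "(\<beta> \<circ> F has_derivative (\<lambda>h. pd (fst h, m * jx h) \<beta> p)) (at p)"
    using diff_chain_at[OF dF, of \<beta>] has_derivative_pd[OF diff(9)[OF p]] by (simp add: Fp o_def)
  moreover
  have "(X \<circ> F has_derivative (\<lambda>h. pd (fst h, m * jx h) X p)) (at p)"
    using diff_chain_at[OF dF, of X] has_derivative_pd[OF diff(2)[OF p]] by (simp add: Fp o_def)
  from diff_chain_at[OF this, of B' "(*) k"] dB'
  have "(B' \<circ> (X \<circ> F) has_derivative (\<lambda>h. k * pd (fst h, m * jx h) X p)) (at p)"
    by (simp add: Fp o_def has_field_derivative_def)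
  then have "(\<beta> \<circ> F has_derivative (\<lambda>h. k * pd (fst h, m * jx h) X p)) (at p)"
    by (rule has_derivative_transform_within_open[OF _ o])
       (use p Fp * in \<open>auto simp: F_def coord_defs\<close>)
  ultimately have "(\<lambda>h. pd (fst h, m * jx h) \<beta> p) = (\<lambda>h. k * pd (fst h, m * jx h) X p)"
    by (rule has_derivative_unique)
  then have 1: "pd (fst h, m * jx h) \<beta> p = k * pd (fst h, m * jx h) X p" for h
    by meson
  \<comment> \<open>The derivative of \<open>F\<close> fixes the directions without x- and
    B-components and sends \<open>ex\<close> to \<open>ex + m *\<^sub>R eb\<close>.\<close>
  have "(fst w, m * jx w) = w" if "w \<in> {et, eu, eut, eux, eutt, eutx, euxx}" for w
    using that by (auto simp: evec_defs coord_defs)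
  then have "pd w \<beta> p = k * pd w X p" if "w \<in> {et, eu, eut, eux, eutt, eutx, euxx}" for w
    using 1[of w] that by metis
  moreover have "(fst ex, m * jx ex) = ex + m *\<^sub>R eb" by (simp add: evec_defs coord_defs)
  then have "pd ex \<beta> p + m * pd eb \<beta> p = k * pd ex X p"
    using 1[of ex] diff[OF p] base0(2)[OF p, of eb] by (simp add: pd_linear)
  moreover have "P p = \<epsilon> * C p + (k * U p + \<beta> p * Q p)"
    if "jut p = \<epsilon> * juxx p + (m * ju p + jb p * jux p)"
  proof -
    have "fst p \<in> fokker_planck_class \<epsilon> UNIV B"
      using that DERIV_imp_deriv[OF dB] by (simp add: fokker_planck_class_iff Bp)
    then have "fst (\<Phi> p) \<in> fokker_planck_class \<epsilon> J B'" using * p Bp by auto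
    then show ?thesis using Xp(2) by (simp add: fokker_planck_class_iff comp_defs k_def)
  qed
  ultimately show ?thesis by blast
qed

text \<open>All other components are independent of B, so a zero here would put \<open>eb\<close>
  into the kernel of the injective \<open>d\<Phi> p\<close>.\<close>

lemma \<beta>_b: assumes p: "p \<in> D" shows "pd eb \<beta> p \<noteq> 0"
proof
  assume "pd eb \<beta> p = 0"
  then have "d\<Phi> p eb = d\<Phi> p 0"
    by (intro extjet2_eqI) (simp_all add: coords_d\<Phi> p base0 jet0 pd_linear diff)
  then have "eb = 0" using bij_d\<Phi>(1)[OF p] injD by metis
  then show False by (simp add: evec_defs zero_prod_def)
qed

lemma X_x: assumes p: "p \<in> D" shows "pd ex X p \<noteq> 0"
proof
  assume "pd ex X p = 0"
  then have "pd ex \<beta> p + m * pd eb \<beta> p = 0" for m using slope[OF p, of m] by auto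
  from this[of 0] this[of 1] show False using \<beta>_b[OF p] by simp
qed

text \<open>The slopes 0 and 1 lead to image slopes \<open>k0\<close> and \<open>k1\<close>, which
  differ because \<open>pd eb \<beta> p\<close> is nonzero; yet both satisfy the same
  proportionality along \<open>w\<close>.\<close>

lemma X0:
  assumes p: "p \<in> D" and w: "w \<in> {et, eu, eut, eux, eutt, eutx, euxx}"
  shows "pd w X p = 0" "pd w \<beta> p = 0"
proof -
  obtain k0 where k0: "pd w \<beta> p = k0 * pd w X p" "pd ex \<beta> p = k0 * pd ex X p"
    using slope[OF p, of 0] w by auto
  obtain k1 where k1: "pd w \<beta> p = k1 * pd w X p" "pd ex \<beta> p + pd eb \<beta> p = k1 * pd ex X p"
    using slope[OF p, of 1] w by auto
  have "k0 \<noteq> k1" using k0 k1 \<beta>_b[OF p] by auto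
  then show "pd w X p = 0" using k0 k1 by simp
  then show "pd w \<beta> p = 0" using k0 by simp
qed

text \<open>Preimages of \<open>et\<close> and \<open>eu\<close> under \<open>d\<Phi> p\<close> have
  no x-component, so their t- and u-components form a right inverse of the 2 by 2 Jacobian matrix;
  the two determinants multiply to 1.\<close>

lemma jacobian: assumes p: "p \<in> D" shows "pd et T p * pd eu U p - pd eu T p * pd et U p \<noteq> 0"
proof -
  have x: "pd v T p = jt v * pd et T p + ju v * pd eu T p"
       "pd v U p = jt v * pd et U p + ju v * pd eu U p" if "pd v X p = 0" for v
    using that pd_expand[OF diff(1)[OF p], of v] pd_expand[OF diff(2)[OF p], of v]
      pd_expand[OF diff(3)[OF p], of v] by (simp_all add: base0 X0 X_x p)
  obtain v where v: "d\<Phi> p v = et" using bij_d\<Phi>(2)[OF p] by (metis surjD)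
  obtain w where w: "d\<Phi> p w = eu" using bij_d\<Phi>(2)[OF p] by (metis surjD)
  have "pd v X p = 0" "pd v T p = 1" "pd v U p = 0" "pd w X p = 0" "pd w T p = 0" "pd w U p = 1"
    using coords_d\<Phi>[OF p, of v] coords_d\<Phi>[OF p, of w] by (simp_all add: v w coords_evecs)
  then have "jt v * pd et T p + ju v * pd eu T p = 1" "jt v * pd et U p + ju v * pd eu U p = 0"
    "jt w * pd et T p + ju w * pd eu T p = 0" "jt w * pd et U p + ju w * pd eu U p = 1"
    using x by metis+
  then have "(pd et T p * pd eu U p - pd eu T p * pd et U p) * (jt v * ju w - ju v * jt w) = 1"
    by algebra
  then show ?thesis by auto
qed

text \<open>The restriction to nonzero u is what allows the equation at a given jet to be solved for
  the slope of the arbitrary element.\<close>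

sublocale det: determining "D \<inter> {p. ju p \<noteq> 0}" \<epsilon> T X U P Q A G C \<beta>
proof
  have "continuous_on UNIV ju" by (rule linear_continuous_on) (rule bounded_linear_coords)
  then show "open (D \<inter> {p. ju p \<noteq> 0})"
    by (intro open_Int D open_Collect_neq) (auto intro: continuous_intros)
  show "smooth_on (D \<inter> {p. ju p \<noteq> 0}) T" "smooth_on (D \<inter> {p. ju p \<noteq> 0}) X"
    "smooth_on (D \<inter> {p. ju p \<noteq> 0}) U" "smooth_on (D \<inter> {p. ju p \<noteq> 0}) P"
    "smooth_on (D \<inter> {p. ju p \<noteq> 0}) Q" "smooth_on (D \<inter> {p. ju p \<noteq> 0}) A"
    "smooth_on (D \<inter> {p. ju p \<noteq> 0}) G" "smooth_on (D \<inter> {p. ju p \<noteq> 0}) C"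
    "smooth_on (D \<inter> {p. ju p \<noteq> 0}) \<beta>"
    by (rule smooth_on_subset[OF smooth(1)] smooth_on_subset[OF smooth(2)]
      smooth_on_subset[OF smooth(3)] smooth_on_subset[OF smooth(4)] smooth_on_subset[OF smooth(5)]
      smooth_on_subset[OF smooth(6)] smooth_on_subset[OF smooth(7)] smooth_on_subset[OF smooth(8)]
      smooth_on_subset[OF smooth(9)], blast)+
  show "\<epsilon> \<noteq> 0" by (rule eps)
next
  fix p w assume p: "p \<in> D \<inter> {p. ju p \<noteq> 0}" and w: "w \<in> {eutt, eutx, euxx, eb}"
  show "pd w P p = 0" "pd w Q p = 0"
  proof -
    have "pd w P p = 0 \<and> pd w Q p = 0"
    proof (cases "w = eb")
      case False
      \<comment> \<open>These directions change only second derivatives, hence lie in the Cartan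
        distribution, and \<open>T\<close> and \<open>X\<close> are constant along them.\<close>
      with w p have "ju w = jut p * jt w + jux p * jx w" "jut w = jutt p * jt w + jutx p * jx w"
        "jux w = jutx p * jt w + juxx p * jx w" "pd w T p = 0" "pd w X p = 0"
        by (auto simp: coords_evecs base0)
      then show ?thesis using contact(2,3)[of p w] p by simp
    qed (use jet0 p in auto)
    then show "pd w P p = 0" "pd w Q p = 0" by auto
  qed
next
  show "\<forall>p\<in>D \<inter> {p. ju p \<noteq> 0}. ju p * pd ex X p * P p = \<epsilon> * ju p * (pd ex X p * C p)
        + (pd ex \<beta> p * ju p + pd eb \<beta> p * (jut p - \<epsilon> * juxx p - jb p * jux p)) * U p
        + \<beta> p * ju p * (pd ex X p * Q p)"
  proof
    fix p assume p: "p \<in> D \<inter> {p. ju p \<noteq> 0}"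
    \<comment> \<open>The slope for which the jet \<open>fst p\<close> satisfies the original
      equation.\<close>
    define m where "m = (jut p - \<epsilon> * juxx p - jb p * jux p) / ju p"
    have m: "m * ju p = jut p - \<epsilon> * juxx p - jb p * jux p" using p by (simp add: m_def)
    obtain k where k: "pd ex \<beta> p + m * pd eb \<beta> p = k * pd ex X p"
      "P p = \<epsilon> * C p + (k * U p + \<beta> p * Q p)"
      using slope[of p m] p m by (auto simp: algebra_simps)
    from k m show "ju p * pd ex X p * P p = \<epsilon> * ju p * (pd ex X p * C p)
        + (pd ex \<beta> p * ju p + pd eb \<beta> p * (jut p - \<epsilon> * juxx p - jb p * jux p)) * U p
        + \<beta> p * ju p * (pd ex X p * Q p)" by algebra
  qed
next
  have *: "pd et U p + jut p * pd eu U p = P p * (pd et T p + jut p * pd eu T p) \<and>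
      pd et P p + jut p * pd eu P p + jutt p * pd eut P p + jutx p * pd eux P p
         = A p * (pd et T p + jut p * pd eu T p) \<and>
      pd et Q p + jut p * pd eu Q p + jutt p * pd eut Q p + jutx p * pd eux Q p
         = G p * (pd et T p + jut p * pd eu T p)"
    if p: "p \<in> D" for p
  proof -
    \<comment> \<open>The total t-derivative truncated at second order; the Cartan conditions leave
      the components along second derivatives free, and here they are zero.\<close>
    define h where "h = et + jut p *\<^sub>R eu + jutt p *\<^sub>R eut + jutx p *\<^sub>R eux"
    have h: "ju h = jut p * jt h + jux p * jx h"
      "jut h = jutt p * jt h + jutx p * jx h" "jux h = jutx p * jt h + juxx p * jx h"
      by (simp_all add: h_def coords_linear coords_evecs)
    have "pd h f p = pd et f p + jut p * pd eu f p + jutt p * pd eut f p + jutx p * pd eux f p"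
      if "f differentiable at p" for f
      using that by (simp add: h_def pd_linear)
    from contact[OF p h] this show ?thesis by (simp add: p diff base0 X0)
  qed
  show "\<forall>p\<in>D \<inter> {p. ju p \<noteq> 0}. pd et U p + jut p * pd eu U p = P p * (pd et T p + jut p * pd eu T p)"
    "\<forall>p\<in>D \<inter> {p. ju p \<noteq> 0}. pd et P p + jut p * pd eu P p + jutt p * pd eut P p + jutx p * pd eux P p
         = A p * (pd et T p + jut p * pd eu T p)"
    "\<forall>p\<in>D \<inter> {p. ju p \<noteq> 0}. pd et Q p + jut p * pd eu Q p + jutt p * pd eut Q p + jutx p * pd eux Q p
         = G p * (pd et T p + jut p * pd eu T p)"
    using * by blast+
next
  have *: "pd ex U p + jux p * pd eu U p
         = P p * (pd ex T p + jux p * pd eu T p) + Q p * pd ex X p \<and>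
      pd ex Q p + jux p * pd eu Q p + jutx p * pd eut Q p + juxx p * pd eux Q p
         = G p * (pd ex T p + jux p * pd eu T p) + C p * pd ex X p"
    if p: "p \<in> D" for p
  proof -
    define h where "h = ex + jux p *\<^sub>R eu + jutx p *\<^sub>R eut + juxx p *\<^sub>R eux"
    have h: "ju h = jut p * jt h + jux p * jx h"
      "jut h = jutt p * jt h + jutx p * jx h" "jux h = jutx p * jt h + juxx p * jx h"
      by (simp_all add: h_def coords_linear coords_evecs)
    have "pd h f p = pd ex f p + jux p * pd eu f p + jutx p * pd eut f p + juxx p * pd eux f p"
      if "f differentiable at p" for f
      using that by (simp add: h_def pd_linear)
    from contact[OF p h] this show ?thesis by (simp add: p diff base0 X0)
  qed
  show "\<forall>p\<in>D \<inter> {p. ju p \<noteq> 0}. pd ex U p + jux p * pd eu U p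
         = P p * (pd ex T p + jux p * pd eu T p) + Q p * pd ex X p"
    "\<forall>p\<in>D \<inter> {p. ju p \<noteq> 0}. pd ex Q p + jux p * pd eu Q p + jutx p * pd eut Q p + juxx p * pd eux Q p
         = G p * (pd ex T p + jux p * pd eu T p) + C p * pd ex X p"
    using * by blast+
next
  fix p assume "p \<in> D \<inter> {p. ju p \<noteq> 0}"
  then have p: "p \<in> D" "ju p \<noteq> 0" by auto
  show "pd eb C p = 0" "ju p \<noteq> 0" "pd ex X p \<noteq> 0" "pd eb \<beta> p \<noteq> 0"
    "pd et T p * pd eu U p - pd eu T p * pd et U p \<noteq> 0"
    using jet0[OF p(1)] X_x[OF p(1)] \<beta>_b[OF p(1)] jacobian[OF p(1)] p by simp_all
  fix w
  show "pd w T p = 0" "pd w U p = 0" if "w \<in> {eut, eux, eutt, eutx, euxx, eb}"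
    using base0[OF p(1) that] by simp_all
  show "pd w X p = 0" if "w \<in> {et, eu, eut, eux, eutt, eutx, euxx, eb}"
    using that base0(2)[OF p(1), of eb] X0(1)[OF p(1), of w] by (cases "w = eb") simp_all
  show "pd w \<beta> p = 0" if "w \<in> {et, eu, eut, eux, eutt, eutx, euxx}"
    using X0(2)[OF p(1) that] .
qed

section \<open>Extension across u = 0 and integration\<close>

lemmas cts = bounded_linear_coords[THEN linear_continuous_on]
  smooth[THEN smooth_on_continuous] smooth[THEN smooth_on_pd, THEN smooth_on_continuous]
  smooth[THEN smooth_on_pd, THEN smooth_on_pd, THEN smooth_on_continuous]
  continuous_on_mult continuous_on_power continuous_on_const

lemma global:
  assumes p: "p \<in> D"
  shows "pd et T p = (pd ex X p)\<^sup>2" "pd ex T p = 0" "pd eu T p = 0" "pd ex U p = 0" "pd et U p = 0"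
    "U p = ju p * pd eu U p" "\<beta> p * pd ex X p = jb p"
    "P p * (pd ex X p)\<^sup>2 = jut p * pd eu U p" "Q p * pd ex X p = jux p * pd eu U p"
    "A p * (pd ex X p) ^ 4 = jutt p * pd eu U p" "G p * (pd ex X p) ^ 3 = jutx p * pd eu U p"
    "C p * (pd ex X p)\<^sup>2 = juxx p * pd eu U p"
    "v \<in> {et, ex, eu, eut, eux, eutt, eutx, euxx, eb} \<Longrightarrow> pd v (pd ex X) p = 0"
    "v \<in> {et, ex, eu, eut, eux, eutt, eutx, euxx, eb} \<Longrightarrow> pd v (pd eu U) p = 0"
  by (rule eq_by_density[OF D(1) p];
      (intro cts | (rule det.X_x_sq det.Tx det.Tu det.U_x0 det.U_t0 det.U_eq det.\<beta>_eq det.P_eq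
        det.Q_eq det.A_eq det.G_eq det.C_eq det.pd_X_x det.pd_U_u; simp)))+

lemma transformation_form:
  obtains c1 c2 c3 c4 where "c1 * c4 \<noteq> 0"
    "\<And>p. p \<in> D \<Longrightarrow> T p = c1\<^sup>2 * jt p + c2" "\<And>p. p \<in> D \<Longrightarrow> X p = c1 * jx p + c3"
    "\<And>p. p \<in> D \<Longrightarrow> U p = c4 * ju p"
    "\<And>p. p \<in> D \<Longrightarrow> P p = c4 / c1\<^sup>2 * jut p" "\<And>p. p \<in> D \<Longrightarrow> Q p = c4 / c1 * jux p"
    "\<And>p. p \<in> D \<Longrightarrow> A p = c4 / c1 ^ 4 * jutt p" "\<And>p. p \<in> D \<Longrightarrow> G p = c4 / c1 ^ 3 * jutx p"
    "\<And>p. p \<in> D \<Longrightarrow> C p = c4 / c1\<^sup>2 * juxx p" "\<And>p. p \<in> D \<Longrightarrow> \<beta> p = 1 / c1 * jb p"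
proof -
  \<comment> \<open>The four constants are read off at one arbitrary point. Connectedness of
    \<open>D\<close> makes \<open>pd ex X\<close>, \<open>pd eu U\<close>, \<open>T\<close> minus
    its linear part and \<open>X\<close> minus its linear part constant.\<close>
  obtain p0 where p0: "p0 \<in> D" using D(3) by blast
  define c1 where "c1 = pd ex X p0"
  define c4 where "c4 = pd eu U p0"
  have c1: "pd ex X p = c1" if "p \<in> D" for p
    unfolding c1_def
    by (rule constant_if_pd_eq_0[OF D(1,2)])
      (auto intro: smooth_on_differentiable[OF smooth_on_pd[OF smooth(2)]] global(13) that p0)
  have c4: "pd eu U p = c4" if "p \<in> D" for p
    unfolding c4_def
    by (rule constant_if_pd_eq_0[OF D(1,2)])
      (auto intro: smooth_on_differentiable[OF smooth_on_pd[OF smooth(3)]] global(14) that p0)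
  have nz: "c1 \<noteq> 0" "c4 \<noteq> 0"
    using X_x[OF p0] jacobian[OF p0] global(3)[OF p0] by (auto simp: c1_def c4_def)
  have T: "T p - c1\<^sup>2 * jt p = T p0 - c1\<^sup>2 * jt p0" if "p \<in> D" for p
  proof (rule constant_if_pd_eq_0[OF D(1,2) _ _ that p0])
    fix q v assume q: "q \<in> D" and v: "v \<in> {et, ex, eu, eut, eux, eutt, eutx, euxx, eb}"
    have "pd v (\<lambda>p. T p - c1\<^sup>2 * jt p) q = pd v T q - c1\<^sup>2 * jt v"
      using diff[OF q] by (simp add: pd_simps)
    also have "\<dots> = 0"
      using v base0(1)[OF q, of v] global(1,2,3)[OF q] c1[OF q] by (auto simp: coords_evecs)
    finally show "pd v (\<lambda>p. T p - c1\<^sup>2 * jt p) q = 0" .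
  qed (use diff in \<open>simp add: differentiable_coords\<close>)
  have X: "X p - c1 * jx p = X p0 - c1 * jx p0" if "p \<in> D" for p
  proof (rule constant_if_pd_eq_0[OF D(1,2) _ _ that p0])
    fix q v assume q: "q \<in> D" and v: "v \<in> {et, ex, eu, eut, eux, eutt, eutx, euxx, eb}"
    have "pd v (\<lambda>p. X p - c1 * jx p) q = pd v X q - c1 * jx v"
      using diff[OF q] by (simp add: pd_simps)
    also have "\<dots> = 0"
      using v base0(2)[OF q, of v] X0(1)[OF q, of v] c1[OF q] by (auto simp: coords_evecs)
    finally show "pd v (\<lambda>p. X p - c1 * jx p) q = 0" .
  qed (use diff in \<open>simp add: differentiable_coords\<close>)
  show thesis
  proof (rule that[of c1 c4 "T p0 - c1\<^sup>2 * jt p0" "X p0 - c1 * jx p0"])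
    show "c1 * c4 \<noteq> 0" using nz by simp
    fix p assume p: "p \<in> D"
    note e = global[OF p, unfolded c1[OF p] c4[OF p]]
    show "T p = c1\<^sup>2 * jt p + (T p0 - c1\<^sup>2 * jt p0)" "X p = c1 * jx p + (X p0 - c1 * jx p0)"
      using T[OF p] X[OF p] by simp_all
    show "U p = c4 * ju p" using e(6) by simp
    show "P p = c4 / c1\<^sup>2 * jut p" using e(8) nz by (simp add: field_simps)
    show "Q p = c4 / c1 * jux p" using e(9) nz by (simp add: field_simps)
    show "A p = c4 / c1 ^ 4 * jutt p" using e(10) nz by (simp add: field_simps)
    show "G p = c4 / c1 ^ 3 * jutx p" using e(11) nz by (simp add: field_simps)
    show "C p = c4 / c1\<^sup>2 * juxx p" using e(12) nz by (simp add: field_simps)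
    show "\<beta> p = 1 / c1 * jb p" using e(7) nz by (simp add: field_simps)
  qed
qed

end

subsection \<open>The equivalence group\<close>

text \<open>The linear part of the prolonged transformation, with \<open>c\<close> and
  \<open>d\<close> in the roles of c1 and c4: each t-derivative costs a factor
  \<open>c\<^sup>2\<close>, each x-derivative a factor \<open>c\<close>.\<close>

definition scaling :: "real \<Rightarrow> real \<Rightarrow> extjet2 \<Rightarrow> extjet2" where
  "scaling c d p = (((c\<^sup>2 * jt p, c * jx p, d * ju p), (d / c\<^sup>2 * jut p, d / c * jux p),
     (d / c ^ 4 * jutt p, d / c ^ 3 * jutx p, d / c\<^sup>2 * juxx p)), 1 / c * jb p)"

lemma coords_scaling:
  "jt (scaling c d p) = c\<^sup>2 * jt p" "jx (scaling c d p) = c * jx p" "ju (scaling c d p) = d * ju p"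
  "jut (scaling c d p) = d / c\<^sup>2 * jut p" "jux (scaling c d p) = d / c * jux p"
  "jutt (scaling c d p) = d / c ^ 4 * jutt p" "jutx (scaling c d p) = d / c ^ 3 * jutx p"
  "juxx (scaling c d p) = d / c\<^sup>2 * juxx p" "jb (scaling c d p) = 1 / c * jb p"
  by (simp_all add: scaling_def coord_defs)

lemma bounded_linear_scaling: "bounded_linear (scaling c d)"
  unfolding linear_conv_bounded_linear[symmetric]
  by (rule linearI; rule extjet2_eqI; simp only: coords_scaling coords_linear; simp add: algebra_simps add_divide_distrib)

lemma scaling_inverse:
  "c * d \<noteq> 0 \<Longrightarrow> scaling (1 / c) (1 / d) (scaling c d p) = p"
  by (rule extjet2_eqI) (simp_all add: coords_scaling power_divide)

lemma scaling_translation_in_equivalence_group: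
  fixes e :: extjet2
  assumes dom: "transformation_domain D" and c: "c * d \<noteq> 0"
    and e: "e = (((a, b, 0), 0), 0)"
    and \<Phi>: "\<And>p. p \<in> D \<Longrightarrow> \<Phi> p = scaling c d p + e"
  shows "(D, \<Phi>) \<in> equivalence_group (fokker_planck_class \<epsilon>)"
proof -
  have D: "open D" using dom by (simp add: transformation_domain_def)
  have e': "jt e = a" "jx e = b" "ju e = 0" "jut e = 0" "jux e = 0" "jutt e = 0" "jutx e = 0"
    "juxx e = 0" "jb e = 0"
    by (simp_all add: e coord_defs)
  let ?L = "scaling c d" and ?L' = "scaling (1 / c) (1 / d)"
  \<comment> \<open>The inverse on the whole space, written as linear part plus constant so that
    smoothness of affine maps applies.\<close>
  define \<Psi> where "\<Psi> q = ?L' q + - ?L' e" for q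
  have \<Psi>: "\<Psi> q = ?L' (q - e)" for q
    using linear_diff[OF bounded_linear.linear[OF bounded_linear_scaling]] by (simp add: \<Psi>_def)
  have \<Psi>\<Phi>: "\<Psi> (?L p + e) = p" for p by (simp add: \<Psi> scaling_inverse[OF c])
  have \<Phi>\<Psi>: "?L (\<Psi> q) + e = q" for q
    using scaling_inverse[of "1 / c" "1 / d" "q - e"] c by (simp add: \<Psi>)
  have d\<Phi>: "(\<Phi> has_derivative ?L) (at p)" if "p \<in> D" for p
    by (rule has_derivative_transform_within_open[OF has_derivative_add_const[OF
          bounded_linear_imp_has_derivative[OF bounded_linear_scaling]] D that])
       (simp add: \<Phi>)
  have "diffeomorphism_on D \<Phi>"
    unfolding diffeomorphism_on_def
  proof (intro conjI exI)
    show "smooth_on D \<Phi>"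
      by (rule smooth_on_cong[OF D _ smooth_on_affine[OF bounded_linear_scaling]]) (simp add: \<Phi>)
    have "\<Phi> ` D = \<Psi> -` D"
    proof (intro equalityI subsetI)
      fix q assume "q \<in> \<Psi> -` D"
      then show "q \<in> \<Phi> ` D" using \<Phi>[of "\<Psi> q"] \<Phi>\<Psi>[of q] by (metis image_eqI vimageE)
    qed (auto simp: \<Phi> \<Psi>\<Phi>)
    moreover have "continuous_on UNIV \<Psi>"
      unfolding \<Psi>_def[abs_def] by (intro smooth_on_continuous smooth_on_affine bounded_linear_scaling)
    ultimately show "open (\<Phi> ` D)" using D open_vimage by metis
    show "smooth_on (\<Phi> ` D) \<Psi>"
      unfolding \<Psi>_def[abs_def] by (intro smooth_on_affine bounded_linear_scaling)
    show "\<forall>p\<in>D. \<Psi> (\<Phi> p) = p" using \<Phi> \<Psi>\<Phi> by simp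
  qed
  moreover have "projectable D \<Phi>"
    unfolding projectable_def
  proof (intro conjI exI ballI)
    fix p assume p: "p \<in> D"
    show "base_of (\<Phi> p) = (\<lambda>(t, x, u). (c\<^sup>2 * t + a, c * x + b, d * u)) (base_of p)"
      by (simp add: \<Phi>[OF p] scaling_def e base_of_def coord_defs case_prod_beta)
    \<comment> \<open>The value 0 for B is a placeholder: the jet components of
      \<open>scaling\<close> do not involve B.\<close>
    show "fst (\<Phi> p) = (\<lambda>z. fst (scaling c d (z, 0) + e)) (fst p)"
      by (simp add: \<Phi>[OF p] scaling_def e coord_defs)
  qed
  moreover have "contact_consistent D \<Phi>"
    unfolding contact_consistent_def
  proof (intro ballI allI)
    fix p v and w :: real assume p: "p \<in> D" and v: "v \<in> cartan (fst p)"
    have "fst (v, w) \<in> cartan (fst p)" using v by simp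
    then have "fst (?L (v, w)) \<in> cartan (fst (\<Phi> p))"
      using c unfolding cartan_iff \<Phi>[OF p] coords_scaling coords_linear e'
      by (simp add: field_simps power2_eq_square power3_eq_cube power4_eq_xxxx)
    then show "fst (frechet_derivative \<Phi> (at p) (v, w)) \<in> cartan (fst (\<Phi> p))"
      using frechet_derivative_at[OF d\<Phi>[OF p]] by metis
  qed
  moreover have "preserves_class (fokker_planck_class \<epsilon>) D \<Phi>"
    unfolding preserves_class_iff
  proof (intro allI impI)
    fix I :: "real set" and B :: "real \<Rightarrow> real"
    assume IB: "open I \<and> smooth_on I B"
    \<comment> \<open>\<open>J\<close> is the image of \<open>I\<close> under x -> c x + b, and
      \<open>B'\<close> is the function whose graph is the image of that of
      \<open>B\<close>.\<close>
    define J where "J = (\<lambda>y. y / c + - b / c) -` I"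
    define B' where "B' y = B (y / c + - b / c) / c" for y
    have J: "open J" unfolding J_def using IB c by (intro open_vimage continuous_intros) auto
    have "smooth_on J (\<lambda>y. B (y / c + - b / c))"
      by (rule smooth_on_compose_affine[OF _ _ _ J, where S = I])
        (use IB in \<open>auto simp: J_def bounded_linear_divide\<close>)
    then have "smooth_on J B'"
      unfolding B'_def[abs_def] by (rule smooth_on_bounded_linear[OF bounded_linear_divide J])
    moreover have "jx (\<Phi> p) \<in> J \<and> jb (\<Phi> p) = B' (jx (\<Phi> p)) \<and>
        (fst p \<in> fokker_planck_class \<epsilon> I B \<longleftrightarrow> fst (\<Phi> p) \<in> fokker_planck_class \<epsilon> J B')"
      if p: "p \<in> D" "jx p \<in> I" "jb p = B (jx p)" for p
    proof -
      have x: "jx (\<Phi> p) / c + - b / c = jx p"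
        using c by (simp add: \<Phi>[OF p(1)] coords_linear coords_scaling e' field_simps)
      then have J': "jx (\<Phi> p) \<in> J" and B': "B' (jx (\<Phi> p)) = B (jx p) / c"
        using p by (simp_all add: J_def B'_def)
      have "B differentiable (at (jx p))" using IB p smooth_on_differentiable by blast
      then have "(B has_real_derivative deriv B (jx p)) (at (jx p))"
        by (simp add: DERIV_deriv_iff_real_differentiable)
      then have B1: "(B has_real_derivative deriv B (jx p)) (at (jx (\<Phi> p) / c + - b / c))"
        by (simp only: x)
      have "((\<lambda>y. y / c + - b / c) has_real_derivative 1 / c) (at (jx (\<Phi> p)))"
        using c by (auto intro!: derivative_eq_intros)
      from DERIV_cdivide[OF DERIV_chain2[OF B1 this], of c]
      have dB': "deriv B' (jx (\<Phi> p)) = deriv B (jx p) / c\<^sup>2"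
        unfolding B'_def[abs_def] by (intro DERIV_imp_deriv) (simp add: power2_eq_square)
      \<comment> \<open>The defect of the equation, left side minus right side, is multiplied by the
        nonzero constant \<open>d / c\<^sup>2\<close>, so it vanishes before the transformation
        exactly when it does after.\<close>
      have "d * (jut p - (\<epsilon> * juxx p + (deriv B (jx p) * ju p + B (jx p) * jux p))) / c\<^sup>2
          = jut (\<Phi> p) - (\<epsilon> * juxx (\<Phi> p) + (deriv B' (jx (\<Phi> p)) * ju (\<Phi> p) + B' (jx (\<Phi> p)) * jux (\<Phi> p)))"
        using c unfolding dB' B'
        by (simp add: \<Phi>[OF p(1)] coords_linear coords_scaling e' field_simps power2_eq_square)
      then have "jut p - (\<epsilon> * juxx p + (deriv B (jx p) * ju p + B (jx p) * jux p)) = 0 \<longleftrightarrow>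
          jut (\<Phi> p) - (\<epsilon> * juxx (\<Phi> p) + (deriv B' (jx (\<Phi> p)) * ju (\<Phi> p) + B' (jx (\<Phi> p)) * jux (\<Phi> p))) = 0"
        using c by (metis divide_eq_0_iff mult_eq_0_iff power_eq_0_iff)
      moreover have "jb (\<Phi> p) = B (jx p) / c"
        by (simp add: \<Phi>[OF p(1)] coords_linear coords_scaling e' p)
      ultimately show ?thesis using J' B' p(2) unfolding fokker_planck_class_iff by simp
    qed
    ultimately show "\<exists>J B'. open J \<and> smooth_on J B' \<and>
        (\<forall>p\<in>D. jx p \<in> I \<and> jb p = B (jx p) \<longrightarrow>
          jx (\<Phi> p) \<in> J \<and> jb (\<Phi> p) = B' (jx (\<Phi> p)) \<and>
          (fst p \<in> fokker_planck_class \<epsilon> I B \<longleftrightarrow> fst (\<Phi> p) \<in> fokker_planck_class \<epsilon> J B'))"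
      using J by blast
  qed
  ultimately show ?thesis using dom by (simp add: equivalence_group_def)
qed

theorem proposition35:
  fixes \<epsilon> :: real
  assumes "\<epsilon> \<in> {-1, 1}"
  shows "equivalence_group (fokker_planck_class \<epsilon>) =
    {(D, \<Phi>). transformation_domain D \<and>
      (\<exists>c1 c2 c3 c4 :: real. c1 * c4 \<noteq> 0 \<and>
        (\<forall>t x u ut ux utt utx uxx b.
          (((t, x, u), (ut, ux), (utt, utx, uxx)), b) \<in> D \<longrightarrow>
          \<Phi> (((t, x, u), (ut, ux), (utt, utx, uxx)), b) =
            (((c1\<^sup>2 * t + c2, c1 * x + c3, c4 * u),
              (c4 / c1\<^sup>2 * ut, c4 / c1 * ux),
              (c4 / c1 ^ 4 * utt, c4 / c1 ^ 3 * utx, c4 / c1\<^sup>2 * uxx)),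
             1 / c1 * b)))}"
    (is "_ = ?S")
proof (intro equalityI subrelI)
  fix D \<Phi> assume "(D, \<Phi>) \<in> equivalence_group (fokker_planck_class \<epsilon>)"
  then interpret symmetry \<epsilon> D \<Phi> using assms by unfold_locales auto
  obtain c1 c2 c3 c4 where c: "c1 * c4 \<noteq> 0"
    and form: "\<And>p. p \<in> D \<Longrightarrow> T p = c1\<^sup>2 * jt p + c2" "\<And>p. p \<in> D \<Longrightarrow> X p = c1 * jx p + c3"
    "\<And>p. p \<in> D \<Longrightarrow> U p = c4 * ju p"
    "\<And>p. p \<in> D \<Longrightarrow> P p = c4 / c1\<^sup>2 * jut p" "\<And>p. p \<in> D \<Longrightarrow> Q p = c4 / c1 * jux p"
    "\<And>p. p \<in> D \<Longrightarrow> A p = c4 / c1 ^ 4 * jutt p" "\<And>p. p \<in> D \<Longrightarrow> G p = c4 / c1 ^ 3 * jutx p"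
    "\<And>p. p \<in> D \<Longrightarrow> C p = c4 / c1\<^sup>2 * juxx p" "\<And>p. p \<in> D \<Longrightarrow> \<beta> p = 1 / c1 * jb p"
    by (rule transformation_form) blast
  have "\<Phi> p = scaling c1 c4 p + (((c2, c3, 0), 0), 0)" if "p \<in> D" for p
    by (rule extjet2_eqI)
      (use form[OF that] in \<open>simp_all add: coords_linear coords_scaling comp_defs, simp_all add: coord_defs\<close>)
  then have "\<forall>t x u ut ux utt utx uxx b. (((t, x, u), (ut, ux), (utt, utx, uxx)), b) \<in> D \<longrightarrow>
          \<Phi> (((t, x, u), (ut, ux), (utt, utx, uxx)), b) =
            (((c1\<^sup>2 * t + c2, c1 * x + c3, c4 * u),
              (c4 / c1\<^sup>2 * ut, c4 / c1 * ux),
              (c4 / c1 ^ 4 * utt, c4 / c1 ^ 3 * utx, c4 / c1\<^sup>2 * uxx)),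
             1 / c1 * b)"
    by (simp add: scaling_def coord_defs)
  moreover have "transformation_domain D" using D by (simp add: transformation_domain_def)
  ultimately show "(D, \<Phi>) \<in> ?S" using c by blast
next
  fix D \<Phi> assume "(D, \<Phi>) \<in> ?S"
  then obtain c1 c2 c3 c4 where dom: "transformation_domain D" and c: "c1 * c4 \<noteq> 0"
    and \<Phi>: "\<And>t x u ut ux utt utx uxx b. (((t, x, u), (ut, ux), (utt, utx, uxx)), b) \<in> D \<Longrightarrow>
          \<Phi> (((t, x, u), (ut, ux), (utt, utx, uxx)), b) =
            (((c1\<^sup>2 * t + c2, c1 * x + c3, c4 * u),
              (c4 / c1\<^sup>2 * ut, c4 / c1 * ux),
              (c4 / c1 ^ 4 * utt, c4 / c1 ^ 3 * utx, c4 / c1\<^sup>2 * uxx)),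
             1 / c1 * b)"
    by auto
  show "(D, \<Phi>) \<in> equivalence_group (fokker_planck_class \<epsilon>)"
  proof (rule scaling_translation_in_equivalence_group[OF dom c refl])
    fix p assume "p \<in> D"
    moreover obtain t x u ut ux utt utx uxx b where "p = (((t,x,u),(ut,ux),(utt,utx,uxx)),b)"
      by (metis surj_pair)
    ultimately show "\<Phi> p = scaling c1 c4 p + (((c2, c3, 0), 0), 0)"
      using \<Phi> by (simp add: scaling_def coord_defs)
  qed
qed

end
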